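(* Every nonzero odd-quadratic odd-symplectic Lie superalgebra is a generalized odd double extension of an odd-quadratic odd-symplectic Lie superalgebra $(\mathfrak h,B_{\mathfrak h},\omega_{\mathfrak h})$ by the one-dimensional Lie superalgebra with null even part.
   Context: All Lie superalgebras are finite dimensional over an algebraically closed field $\mathbb K$ of characteristic zero; $|x|\in\mathbb Z_2$ is the degree of a homogeneous $X$. A bilinear form on $\mathfrak g$ is odd if it vanishes on $\mathfrak g_\alpha\times\mathfrak g_\alpha$ for all $\alpha\in\mathbb Z_2$. An odd-invariant scalar product $B$ on $\mathfrak g$ is an odd, supersymmetric ($B(X,Y)=(-1)^{|x||y|}B(Y,X)$), invariant ($B([X,Y],Z)=B(X,[Y,Z])$), non-degenerate bilinear form. An odd-symplectic form is an odd, skew-supersymmetric ($\omega(X,Y)=-(-1)^{|x||y|}\omega(Y,X)$), non-degenerate bilinear form with $(-1)^{|z||x|}\omega(X,[Y,Z])+(-1)^{|x||y|}\omega(Y,[Z,X])+(-1)^{|y||z|}\omega(Z,[X,Y])=0$. An odd-quadratic odd-symplectic Lie superalgebra $(\mathfrak g,B,\omega)$ is a Lie superalgebra with an odd-invariant scalar product $B$ and an odd-symplectic form $\omega$; then there is a unique even invertible superderivation $\delta$ with $\omega(X,Y)=B(\delta(X),Y)$, and it is skew-supersymmetric. A superderivation $\Delta$ of degree $d$ satisfies $\Delta(\mathfrak g_\alpha)\subseteq \mathfrak g_{\alpha+d}$ and $\Delta[X,Y]=[\Delta(X),Y]+(-1)^{d|x|}[X,\Delta(Y)]$; it is skew-supersymmetric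 (also called skew-symmetric) for $B$ if $B(\Delta(X),Y)=-(-1)^{d|x|}B(X,\Delta(Y))$. $[\delta,\bar D]$ denotes the supercommutator. Generalized odd double extension by the one-dimensional Lie superalgebra with null even part. Let $(\mathfrak h,B,\omega)$ be odd-quadratic odd-symplectic with associated even invertible superderivation $\delta$. Let $\bar D$ be an odd skew-supersymmetric superderivation of $(\mathfrak h,B)$, $x_0\in\mathfrak h_{\bar0}$, $k\in\mathbb K$, $c_1\in\mathfrak h_{\bar1}$ and $\lambda\in\mathbb K\setminus\{0\}$ such that $\bar D(x_0)=0$, $\bar D^2=\frac12\mathrm{ad}_{\mathfrak h}(x_0)$, $B(c_1,x_0)=\lambda k$, $2\bar D(c_1)=\delta(x_0)+2\lambda x_0$, $[\delta,\bar D]+\lambda\bar D=\mathrm{ad}_{\mathfrak h}(c_1)$. On $\widetilde{\mathfrak g}=\mathbb Ke^*\oplus\mathfrak h\oplus\mathbb Ke$ ($e$ odd, $e^*$ even) define the bracket by $[e,e]=x_0+ke^*$, $[e,X]=\bar D(X)+B(x_0,X)e^*$, $[X,Y]=[X,Y]_{\mathfrak h}+B(\bar D(X),Y)e^*$ for $X,Y\in\mathfrak h$, $e^*$ central; the supersymmetric form $\widetilde B$ by $\widetilde B|_{\mathfrak h\times\mathfrak h}=B$, $\widetilde B(e^*,e)=1$, all other pairings zero; and $\Delta$ by $\Delta(e^* )=\lambda e^*$, $\Delta(X)=\delta(X)-B(c_1,X)e^*$, $\Delta(e)=-\lambda e+c_1$. Then $(\widetilde{\mathfrak g},\widetilde B,\widetilde\omega)$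 with $\widetilde\omega(\cdot,\cdot)=\widetilde B(\Delta(\cdot),\cdot)$ is an odd-quadratic odd-symplectic Lie superalgebra, called the generalized odd double extension of $(\mathfrak h,B,\omega)$ by the one-dimensional Lie superalgebra (with null even part) by means of $(\bar D,x_0,c_1,\lambda)$. "Is a generalized odd double extension" means up to isomorphism of Lie superalgebras preserving both forms. *)

theory Defs
  imports
    "HOL-Computational_Algebra.Polynomial"
    "HOL-Library.Z2"
    "HOL-Library.Product_Plus"
begin

text \<open>
  Algebras live on subspaces of an ambient vector space \<open>'v\<close>, so that algebras of different
  dimension can be related in one statement.  Operations are total functions on \<open>'v\<close>, but only
  their values on the underlying subspace matter.
\<close>

record 'v superalgebra =
  grade :: "bit \<Rightarrow> 'v set"
  bracket :: "'v \<Rightarrow> 'v \<Rightarrow> 'v"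

record ('k, 'v) bi_form_superalgebra = "'v superalgebra" +
  form :: "'v \<Rightarrow> 'v \<Rightarrow> 'k"
  sympl :: "'v \<Rightarrow> 'v \<Rightarrow> 'k"

definition carrier :: "('v::plus, 'x) superalgebra_scheme \<Rightarrow> 'v set" where
  "carrier L = {x + y | x y. x \<in> grade L 0 \<and> y \<in> grade L 1}"

text \<open>The homogeneous component of degree \<open>\<alpha>\<close>; note \<open>\<alpha> + 1\<close> is the other degree.\<close>

definition hcomp :: "('v::ab_group_add, 'x) superalgebra_scheme \<Rightarrow> bit \<Rightarrow> 'v \<Rightarrow> 'v" where
  "hcomp L \<alpha> x = (THE y. y \<in> grade L \<alpha> \<and> x - y \<in> grade L (\<alpha> + 1))"

text \<open>The sign \<open>(-1)^\<alpha>\<close>.\<close>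

definition zsign :: "bit \<Rightarrow> 'k::ring_1" where
  "zsign \<alpha> = (if \<alpha> = 0 then 1 else - 1)"

definition linear_on ::
    "'v::plus set \<Rightarrow> ('k \<Rightarrow> 'v \<Rightarrow> 'v) \<Rightarrow> ('k \<Rightarrow> 'w \<Rightarrow> 'w) \<Rightarrow> ('v \<Rightarrow> 'w::plus) \<Rightarrow> bool" where
  "linear_on S s t f \<longleftrightarrow>
     (\<forall>x\<in>S. \<forall>y\<in>S. f (x + y) = f x + f y) \<and> (\<forall>c. \<forall>x\<in>S. f (s c x) = t c (f x))"

definition bilinear_on ::
    "'v::plus set \<Rightarrow> ('k \<Rightarrow> 'v \<Rightarrow> 'v) \<Rightarrow> ('k \<Rightarrow> 'w \<Rightarrow> 'w) \<Rightarrow> ('v \<Rightarrow> 'v \<Rightarrow> 'w::plus) \<Rightarrow> bool" where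
  "bilinear_on S s t b \<longleftrightarrow>
     (\<forall>x\<in>S. linear_on S s t (\<lambda>y. b x y)) \<and> (\<forall>y\<in>S. linear_on S s t (\<lambda>x. b x y))"

locale lie_superalgebra = vector_space scale
  for scale :: "'k::{alg_closed_field, field_char_0} \<Rightarrow> 'v::ab_group_add \<Rightarrow> 'v" +
  fixes L :: "('v, 'x) superalgebra_scheme"
  assumes subspace_grade: "subspace (grade L \<alpha>)"
    and grade_Int: "grade L 0 \<inter> grade L 1 = {0}"
    and finite_dim: "\<exists>A. finite A \<and> carrier L = span A"
    and bracket_bilinear: "bilinear_on (carrier L) scale scale (bracket L)"
    and bracket_grade:
      "\<lbrakk>x \<in> grade L \<alpha>; y \<in> grade L \<beta>\<rbrakk> \<Longrightarrow> bracket L x y \<in> grade L (\<alpha> + \<beta>)"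
    and bracket_skew:
      "\<lbrakk>x \<in> grade L \<alpha>; y \<in> grade L \<beta>\<rbrakk>
        \<Longrightarrow> bracket L x y = - scale (zsign (\<alpha> * \<beta>)) (bracket L y x)"
    and super_jacobi:
      "\<lbrakk>x \<in> grade L \<alpha>; y \<in> grade L \<beta>; z \<in> grade L \<gamma>\<rbrakk>
        \<Longrightarrow> scale (zsign (\<gamma> * \<alpha>)) (bracket L x (bracket L y z))
          + scale (zsign (\<alpha> * \<beta>)) (bracket L y (bracket L z x))
          + scale (zsign (\<beta> * \<gamma>)) (bracket L z (bracket L x y)) = 0"

definition odd_form ::
    "('v, 'x) superalgebra_scheme \<Rightarrow> ('v \<Rightarrow> 'v \<Rightarrow> 'k::zero) \<Rightarrow> bool" where
  "odd_form L b \<longleftrightarrow> (\<forall>\<alpha>. \<forall>x\<in>grade L \<alpha>. \<forall>y\<in>grade L \<alpha>. b x y = 0)"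

definition nondegenerate ::
    "('v::{plus, zero}, 'x) superalgebra_scheme \<Rightarrow> ('v \<Rightarrow> 'v \<Rightarrow> 'k::zero) \<Rightarrow> bool" where
  "nondegenerate L b \<longleftrightarrow>
     (\<forall>x\<in>carrier L. (\<forall>y\<in>carrier L. b x y = 0) \<longrightarrow> x = 0) \<and>
     (\<forall>y\<in>carrier L. (\<forall>x\<in>carrier L. b x y = 0) \<longrightarrow> y = 0)"

definition odd_invariant_scalar_product ::
    "('k::field \<Rightarrow> 'v \<Rightarrow> 'v) \<Rightarrow> ('v::ab_group_add, 'x) superalgebra_scheme
      \<Rightarrow> ('v \<Rightarrow> 'v \<Rightarrow> 'k) \<Rightarrow> bool" where
  "odd_invariant_scalar_product s L B \<longleftrightarrow>
     bilinear_on (carrier L) s (*) B \<and>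
     odd_form L B \<and>
     (\<forall>\<alpha> \<beta>. \<forall>x\<in>grade L \<alpha>. \<forall>y\<in>grade L \<beta>. B x y = zsign (\<alpha> * \<beta>) * B y x) \<and>
     (\<forall>x\<in>carrier L. \<forall>y\<in>carrier L. \<forall>z\<in>carrier L.
        B (bracket L x y) z = B x (bracket L y z)) \<and>
     nondegenerate L B"

definition odd_symplectic_form ::
    "('k::field \<Rightarrow> 'v \<Rightarrow> 'v) \<Rightarrow> ('v::ab_group_add, 'x) superalgebra_scheme
      \<Rightarrow> ('v \<Rightarrow> 'v \<Rightarrow> 'k) \<Rightarrow> bool" where
  "odd_symplectic_form s L \<omega> \<longleftrightarrow>
     bilinear_on (carrier L) s (*) \<omega> \<and>
     odd_form L \<omega> \<and>
     (\<forall>\<alpha> \<beta>. \<forall>x\<in>grade L \<alpha>. \<forall>y\<in>grade L \<beta>. \<omega> x y = - zsign (\<alpha> * \<beta>) * \<omega> y x) \<and>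
     nondegenerate L \<omega> \<and>
     (\<forall>\<alpha> \<beta> \<gamma>. \<forall>x\<in>grade L \<alpha>. \<forall>y\<in>grade L \<beta>. \<forall>z\<in>grade L \<gamma>.
        zsign (\<gamma> * \<alpha>) * \<omega> x (bracket L y z)
        + zsign (\<alpha> * \<beta>) * \<omega> y (bracket L z x)
        + zsign (\<beta> * \<gamma>) * \<omega> z (bracket L x y) = 0)"

locale odd_quadratic_odd_symplectic = lie_superalgebra scale L
  for scale :: "'k::{alg_closed_field, field_char_0} \<Rightarrow> 'v::ab_group_add \<Rightarrow> 'v"
    and L :: "('k, 'v, 'x) bi_form_superalgebra_scheme" +
  assumes form: "odd_invariant_scalar_product scale L (form L)"
    and sympl: "odd_symplectic_form scale L (sympl L)"

definition superderivation ::
    "('k::field \<Rightarrow> 'v \<Rightarrow> 'v) \<Rightarrow> ('v::ab_group_add, 'x) superalgebra_scheme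
      \<Rightarrow> bit \<Rightarrow> ('v \<Rightarrow> 'v) \<Rightarrow> bool" where
  "superderivation s L d \<Delta> \<longleftrightarrow>
     linear_on (carrier L) s s \<Delta> \<and>
     (\<forall>\<alpha>. \<Delta> ` grade L \<alpha> \<subseteq> grade L (\<alpha> + d)) \<and>
     (\<forall>\<alpha>. \<forall>x\<in>grade L \<alpha>. \<forall>y\<in>carrier L.
        \<Delta> (bracket L x y) = bracket L (\<Delta> x) y + s (zsign (d * \<alpha>)) (bracket L x (\<Delta> y)))"

definition skew_supersymmetric ::
    "('k::field, 'v::ab_group_add, 'x) bi_form_superalgebra_scheme
      \<Rightarrow> bit \<Rightarrow> ('v \<Rightarrow> 'v) \<Rightarrow> bool" where
  "skew_supersymmetric L d \<Delta> \<longleftrightarrow>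
     (\<forall>\<alpha>. \<forall>x\<in>grade L \<alpha>. \<forall>y\<in>carrier L.
        form L (\<Delta> x) y = - zsign (d * \<alpha>) * form L x (\<Delta> y))"

definition supercommutator ::
    "('k::field \<Rightarrow> 'v \<Rightarrow> 'v) \<Rightarrow> bit \<Rightarrow> bit \<Rightarrow> ('v \<Rightarrow> 'v) \<Rightarrow> ('v \<Rightarrow> 'v)
      \<Rightarrow> 'v \<Rightarrow> 'v::ab_group_add" where
  "supercommutator s d d' f g x = f (g x) - s (zsign (d * d')) (g (f x))"

text \<open>
  The superderivation with \<open>\<omega>(X,Y) = B(\<delta>(X),Y)\<close>; its values on \<open>carrier L\<close> are determined by
  nondegeneracy of \<open>B\<close>.
\<close>

definition associated_superderivation ::
    "('k::field \<Rightarrow> 'v \<Rightarrow> 'v) \<Rightarrow> ('k, 'v::ab_group_add, 'x) bi_form_superalgebra_scheme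
      \<Rightarrow> ('v \<Rightarrow> 'v) \<Rightarrow> bool" where
  "associated_superderivation s L \<delta> \<longleftrightarrow>
     superderivation s L 0 \<delta> \<and>
     bij_betw \<delta> (carrier L) (carrier L) \<and>
     (\<forall>x\<in>carrier L. \<forall>y\<in>carrier L. sympl L x y = form L (\<delta> x) y)"

definition odd_double_extension_data ::
    "('k::field \<Rightarrow> 'v \<Rightarrow> 'v) \<Rightarrow> ('k, 'v::ab_group_add, 'x) bi_form_superalgebra_scheme
      \<Rightarrow> ('v \<Rightarrow> 'v) \<Rightarrow> ('v \<Rightarrow> 'v) \<Rightarrow> 'v \<Rightarrow> 'k \<Rightarrow> 'v \<Rightarrow> 'k \<Rightarrow> bool" where
  "odd_double_extension_data s H \<delta> D x\<^sub>0 k c\<^sub>1 l \<longleftrightarrow>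
     associated_superderivation s H \<delta> \<and>
     superderivation s H 1 D \<and>
     skew_supersymmetric H 1 D \<and>
     x\<^sub>0 \<in> grade H 0 \<and> c\<^sub>1 \<in> grade H 1 \<and> l \<noteq> 0 \<and>
     D x\<^sub>0 = 0 \<and>
     (\<forall>x\<in>carrier H. D (D x) = s (1 / 2) (bracket H x\<^sub>0 x)) \<and>
     form H c\<^sub>1 x\<^sub>0 = l * k \<and>
     s 2 (D c\<^sub>1) = \<delta> x\<^sub>0 + s (2 * l) x\<^sub>0 \<and>
     (\<forall>x\<in>carrier H. supercommutator s 0 1 \<delta> D x + s l (D x) = bracket H c\<^sub>1 x)"

text \<open>
  The triple \<open>(a, X, b)\<close> stands for \<open>a e\<^sup>* + X + b e\<close>.  The bracket is the bilinear extension of the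
  defining relations.  Those give \<open>[e, Y]\<close>; super-antisymmetry gives \<open>[X, e] = - (-1)^\<alpha> [e, X]\<close>
  for \<open>X\<close> of degree \<open>\<alpha>\<close>, hence \<open>[X, e] = [e, X\<^sub>1 - X\<^sub>0]\<close> in general, where \<open>X = X\<^sub>0 + X\<^sub>1\<close>.
\<close>

definition ext_scale ::
    "('k::field \<Rightarrow> 'v \<Rightarrow> 'v) \<Rightarrow> 'k \<Rightarrow> 'k \<times> 'v \<times> 'k \<Rightarrow> 'k \<times> 'v \<times> 'k" where
  "ext_scale s c = (\<lambda>(a, x, b). (c * a, s c x, c * b))"

definition ext_grade ::
    "('v, 'x) superalgebra_scheme \<Rightarrow> bit \<Rightarrow> ('k::field \<times> 'v \<times> 'k) set" where
  "ext_grade H \<alpha> =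
     (if \<alpha> = 0 then {(a, x, 0) | a x. x \<in> grade H 0} else {(0, x, b) | x b. x \<in> grade H 1})"

definition ext_bracket ::
    "('k::field \<Rightarrow> 'v \<Rightarrow> 'v) \<Rightarrow> ('k, 'v::ab_group_add, 'x) bi_form_superalgebra_scheme
      \<Rightarrow> ('v \<Rightarrow> 'v) \<Rightarrow> 'v \<Rightarrow> 'k
      \<Rightarrow> 'k \<times> 'v \<times> 'k \<Rightarrow> 'k \<times> 'v \<times> 'k \<Rightarrow> 'k \<times> 'v \<times> 'k" where
  "ext_bracket s H D x\<^sub>0 k = (\<lambda>(a, x, b) (a', y, b').
     let x' = hcomp H 1 x - hcomp H 0 x in
       (form H (D x) y + b * form H x\<^sub>0 y + b' * form H x\<^sub>0 x' + b * b' * k,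
        bracket H x y + s b (D y) + s b' (D x') + s (b * b') x\<^sub>0,
        0))"

definition ext_form ::
    "('k::field, 'v, 'x) bi_form_superalgebra_scheme
      \<Rightarrow> 'k \<times> 'v \<times> 'k \<Rightarrow> 'k \<times> 'v \<times> 'k \<Rightarrow> 'k" where
  "ext_form H = (\<lambda>(a, x, b) (a', y, b'). form H x y + a * b' + b * a')"

definition ext_derivation ::
    "('k::field \<Rightarrow> 'v \<Rightarrow> 'v) \<Rightarrow> ('k, 'v::ab_group_add, 'x) bi_form_superalgebra_scheme
      \<Rightarrow> ('v \<Rightarrow> 'v) \<Rightarrow> 'v \<Rightarrow> 'k \<Rightarrow> 'k \<times> 'v \<times> 'k \<Rightarrow> 'k \<times> 'v \<times> 'k" where
  "ext_derivation s H \<delta> c\<^sub>1 l = (\<lambda>(a, x, b). (l * a - form H c\<^sub>1 x, \<delta> x + s b c\<^sub>1, - (l * b)))"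

definition odd_double_extension ::
    "('k::field \<Rightarrow> 'v \<Rightarrow> 'v) \<Rightarrow> ('k, 'v::ab_group_add, 'x) bi_form_superalgebra_scheme
      \<Rightarrow> ('v \<Rightarrow> 'v) \<Rightarrow> ('v \<Rightarrow> 'v) \<Rightarrow> 'v \<Rightarrow> 'k \<Rightarrow> 'v \<Rightarrow> 'k
      \<Rightarrow> ('k, 'k \<times> 'v \<times> 'k) bi_form_superalgebra" where
  "odd_double_extension s H \<delta> D x\<^sub>0 k c\<^sub>1 l =
     \<lparr>grade = ext_grade H,
      bracket = ext_bracket s H D x\<^sub>0 k,
      form = ext_form H,
      sympl = (\<lambda>u v. ext_form H (ext_derivation s H \<delta> c\<^sub>1 l u) v)\<rparr>"

definition bi_form_isomorphism ::
    "('k::field \<Rightarrow> 'v \<Rightarrow> 'v) \<Rightarrow> ('k, 'v::ab_group_add, 'x) bi_form_superalgebra_scheme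
      \<Rightarrow> ('k \<Rightarrow> 'w \<Rightarrow> 'w) \<Rightarrow> ('k, 'w::ab_group_add, 'y) bi_form_superalgebra_scheme
      \<Rightarrow> ('v \<Rightarrow> 'w) \<Rightarrow> bool" where
  "bi_form_isomorphism s L t M \<phi> \<longleftrightarrow>
     linear_on (carrier L) s t \<phi> \<and>
     bij_betw \<phi> (carrier L) (carrier M) \<and>
     (\<forall>\<alpha>. \<phi> ` grade L \<alpha> = grade M \<alpha>) \<and>
     (\<forall>x\<in>carrier L. \<forall>y\<in>carrier L.
        \<phi> (bracket L x y) = bracket M (\<phi> x) (\<phi> y) \<and>
        form M (\<phi> x) (\<phi> y) = form L x y \<and>
        sympl M (\<phi> x) (\<phi> y) = sympl L x y)"

definition is_generalized_odd_double_extension ::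
    "('k::field \<Rightarrow> 'v \<Rightarrow> 'v) \<Rightarrow> ('k, 'v::ab_group_add, 'x) bi_form_superalgebra_scheme
      \<Rightarrow> ('k \<Rightarrow> 'w \<Rightarrow> 'w) \<Rightarrow> ('k, 'w::ab_group_add, 'y) bi_form_superalgebra_scheme
      \<Rightarrow> bool" where
  "is_generalized_odd_double_extension s L t H \<longleftrightarrow>
     (\<exists>\<delta> D x\<^sub>0 k c\<^sub>1 l \<phi>.
        odd_double_extension_data t H \<delta> D x\<^sub>0 k c\<^sub>1 l \<and>
        bi_form_isomorphism s L (ext_scale t) (odd_double_extension t H \<delta> D x\<^sub>0 k c\<^sub>1 l) \<phi>)"

end

theory Submission
  imports Defs
begin

text \<open>
  Let \<open>\<delta>\<close> be the even superderivation with \<open>\<omega>(X,Y) = B(\<delta>(X),Y)\<close>.  Everything rests on finding a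
  nonzero even central eigenvector \<open>e\<^sup>*\<close> of \<open>\<delta>\<close>; the extension is then the reverse of dividing
  \<open>(e\<^sup>*)\<^sup>\<bottom>\<close> by \<open>e\<^sup>*\<close>.

  The even part \<open>\<gg>\<^sub>0\<close> is a Lie algebra on which \<open>\<delta>\<close> is an injective derivation, so a theorem of Jacobson
  makes \<open>\<gg>\<^sub>0\<close> nilpotent.  Only a nonzero centre is needed, and \<open>central_eigenvector_exists\<close> obtains it
  by running Engel's argument inside the subalgebras stable under \<open>\<delta>\<close>: all weights of \<open>\<delta>\<close> are nonzero
  and there are finitely many of them, so in characteristic zero \<open>ad v\<close> is nilpotent for every
  generalized eigenvector \<open>v\<close> (\<open>ad_gen_eigen_nilpotent\<close>), and a proper \<open>\<delta>\<close>-stable subalgebra acting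
  nilpotently can always be enlarged by such a \<open>v\<close> (\<open>nil_subalgebra_extend\<close>).

  The centre of \<open>\<gg>\<^sub>0\<close> is even central in the whole of \<open>\<gg>\<close>: for \<open>z\<close> in it, \<open>x\<close> odd and \<open>y\<close> even,
  \<open>B([z,x],y) = - B(x,[z,y]) = 0\<close>, and \<open>B([z,x],y) = 0\<close> for odd \<open>y\<close> because \<open>B\<close> is odd.  This gives
  \<open>e\<^sup>*\<close> with \<open>\<delta>(e\<^sup>*) = \<lambda> e\<^sup>*\<close>, and \<open>\<lambda> \<noteq> 0\<close> as \<open>\<delta>\<close> is injective.

  Choose an odd \<open>e\<close> with \<open>B(e\<^sup>*,e) = 1\<close>, let \<open>\<hh>\<close> be the orthogonal of \<open>{e\<^sup>*, e}\<close> and \<open>P\<close> the orthogonal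
  projection onto it.  As \<open>e\<^sup>*\<close> is central and \<open>[\<gg>,\<gg>]\<close> is orthogonal to it, \<open>P\<close> may be dropped inside
  nested brackets, so \<open>\<hh>\<close> with bracket \<open>P[X,Y]\<close> inherits every identity of \<open>\<gg>\<close>; it is a copy of
  \<open>(e\<^sup>*)\<^sup>\<bottom> / \<K>e\<^sup>*\<close>.  The data are \<open>D = P[e,-]\<close>, \<open>x\<^sub>0 + k e\<^sup>* = [e,e]\<close> and \<open>c\<^sub>1 - \<lambda> e = \<delta>(e)\<close>.
  Their relations are the \<open>\<hh>\<close>-components of the Jacobi identity for \<open>(e,e,e)\<close> and \<open>(e,e,X)\<close> and of the
  derivation rule for \<open>\<delta>[e,e]\<close> and \<open>\<delta>[e,X]\<close>; only \<open>B(c\<^sub>1,x\<^sub>0) = \<lambda>k\<close> is the \<open>e\<^sup>*\<close>-component of the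
  rule for \<open>\<delta>[e,e]\<close>.  Finally \<open>X \<mapsto> (B(X,e), P X, B(e\<^sup>*,X))\<close> is the isomorphism.
\<close>

section \<open>Finite-dimensional linear algebra\<close>

context vector_space
begin

lemma linear_relation_exists:
  fixes f :: "nat \<Rightarrow> 'b"
  assumes fin: "finite A" and f: "\<And>i. f i \<in> span A"
  shows "\<exists>c. (\<exists>i\<le>card A. c i \<noteq> 0) \<and> (\<Sum>i\<le>card A. scale (c i) (f i)) = 0"
proof (cases "inj_on f {..card A}")
  case True
  let ?I = "{..card A}"
  have "\<not> independent (f ` ?I)"
  proof
    assume "independent (f ` ?I)"
    then have "card (f ` ?I) \<le> card A"
      using independent_span_bound[OF fin] f by blast
    then show False using True by (simp add: card_image)
  qed
  then obtain u where u: "\<exists>v\<in>f ` ?I. u v \<noteq> 0" "(\<Sum>v\<in>f ` ?I. scale (u v) v) = 0"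
    using dependent_finite[of "f ` ?I"] by auto
  have "(\<Sum>i\<in>?I. scale (u (f i)) (f i)) = 0"
    using u(2) sum.reindex[OF True, of "\<lambda>v. scale (u v) v"] by (simp add: o_def)
  then show ?thesis using u(1) by (intro exI[of _ "\<lambda>i. u (f i)"]) auto
next
  case False
  then obtain i j where ij: "i \<le> card A" "j \<le> card A" "i \<noteq> j" "f i = f j"
    by (auto simp: inj_on_def)
  let ?c = "\<lambda>n. if n = i then 1 else if n = j then -1 else (0::'a)"
  have "(\<Sum>n\<le>card A. scale (?c n) (f n)) = (\<Sum>n\<in>{i,j}. scale (?c n) (f n))"
    by (rule sum.mono_neutral_right) (use ij in auto)
  also have "\<dots> = 0" using ij by simp
  finally show ?thesis using ij by (intro exI[of _ ?c]) auto
qed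

text \<open>
  The ambient space may be infinite dimensional, so injectivity gives surjectivity only after
  comparing the size of an image basis with that of a basis of the subspace.
\<close>

lemma injective_image_spans:
  assumes lin: "Vector_Spaces.linear scale scale f" and fin: "finite A" and ind: "independent A"
    and into: "f ` span A \<subseteq> span A" and inj: "\<And>x. x \<in> span A \<Longrightarrow> f x = 0 \<Longrightarrow> x = 0"
  shows "f ` span A = span A"
proof
  interpret f: Vector_Spaces.linear scale scale f by (rule lin)
  have io: "inj_on f (span A)"
    using inj by (auto simp: f.inj_on_iff_eq_0[OF subspace_span])
  have indf: "independent (f ` A)"
    by (rule f.independent_injective_image[OF ind io])
  have card: "card (f ` A) = card A"
    by (rule card_image) (use io span_superset inj_on_subset in blast)
  have eq: "f ` span A = span (f ` A)" by (rule f.span_image[symmetric])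
  show "span A \<subseteq> f ` span A"
  proof
    fix x assume x: "x \<in> span A"
    show "x \<in> f ` span A"
    proof (rule ccontr)
      assume "x \<notin> f ` span A"
      then have nx: "x \<notin> span (f ` A)" using eq by simp
      then have "independent (insert x (f ` A))" using indf by (rule independent_insertI)
      moreover have "insert x (f ` A) \<subseteq> span A" using x into span_superset by blast
      ultimately have "card (insert x (f ` A)) \<le> card A"
        using independent_span_bound[OF fin] by blast
      moreover have "x \<notin> f ` A" using nx span_superset by blast
      ultimately show False using card fin by simp
    qed
  qed
qed (rule into)

text \<open>
  The map \<open>\<beta>(x) = \<Sum>c. b(x,c) c\<close>, summed over a basis, encodes the functional \<open>b(x,-)\<close> as a vector of
  the same space.  It is injective by nondegeneracy, hence surjective, so the vector that encodes \<open>f\<close>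
  is also attained.  This avoids the dual space.
\<close>

lemma nondegenerate_form_represents:
  assumes V: "subspace V" and fin: "finite A" "V = span A"
    and bil: "bilinear_on V scale (*) b"
    and nd: "\<And>x. x \<in> V \<Longrightarrow> \<forall>y\<in>V. b x y = 0 \<Longrightarrow> x = 0"
    and f: "linear_on V scale (*) f"
  shows "\<exists>y\<in>V. \<forall>x\<in>V. b y x = f x"
proof -
  obtain C where C: "C \<subseteq> V" "independent C" "V \<subseteq> span C"
    using maximal_independent_subset by blast
  have sp: "V = span C"
    using C V by (metis span_minimal subset_antisym)
  have finC: "finite C"
    using independent_span_bound[OF fin(1) C(2)] C(1) fin(2) by blast
  \<comment> \<open>a functional is determined by its values on the basis \<open>C\<close>\<close>
  have agree: "g x = h x" if x: "x \<in> V" and g: "linear_on V scale (*) g" and h: "linear_on V scale (*) h"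
    and eq: "\<And>c. c \<in> C \<Longrightarrow> g c = h c" for g h :: "'b \<Rightarrow> 'a" and x
  proof -
    have "x \<in> {x \<in> V. g x = h x}"
    proof (rule span_induct_alt[of x C "\<lambda>x. x \<in> {x \<in> V. g x = h x}"])
      show "x \<in> span C" using x sp by simp
      show "0 \<in> {x \<in> V. g x = h x}"
        using g h subspace_0[OF V] unfolding linear_on_def
        by (auto, metis mult_zero_left scale_zero_left)
      fix c x y assume "x \<in> C" "y \<in> {x \<in> V. g x = h x}"
      then show "scale c x + y \<in> {x \<in> V. g x = h x}"
        using g h eq C(1) subspace_add[OF V] subspace_scale[OF V] unfolding linear_on_def
        by (auto simp: subset_iff)
    qed
    then show ?thesis by simp
  qed
  let ?T = "\<lambda>g. (\<Sum>c\<in>C. scale (g c) c)"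
  have Tinj: "g c = h c" if "?T g = ?T h" "c \<in> C" for g h :: "'b \<Rightarrow> 'a" and c
  proof -
    have "(\<Sum>c\<in>C. scale (g c - h c) c) = 0"
      using that by (simp add: scale_left_diff_distrib sum_subtractf)
    then show ?thesis
      using C(2) dependent_finite[OF finC] that(2) by (metis eq_iff_diff_eq_0)
  qed
  interpret vp: vector_space_pair scale scale ..
  obtain \<beta> where \<beta>: "Vector_Spaces.linear scale scale \<beta>" "\<And>x. x \<in> C \<Longrightarrow> \<beta> x = ?T (b x)"
    using vp.linear_independent_extend[OF C(2), of "\<lambda>x. ?T (b x)"] by blast
  interpret \<beta>: Vector_Spaces.linear scale scale \<beta> by (rule \<beta>(1))
  have \<beta>_eq: "\<beta> x = ?T (b x)" if "x \<in> V" for x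
  proof -
    have "x \<in> V \<and> \<beta> x = ?T (b x)"
    proof (rule span_induct_alt[of x C])
      show "x \<in> span C" using that sp by simp
      have "b 0 c = 0" if "c \<in> C" for c
      proof -
        have "c \<in> V" using that C by blast
        then have "b (scale 0 0) c = 0 * b 0 c"
          using bil subspace_0[OF V] unfolding bilinear_on_def linear_on_def by blast
        then show ?thesis by simp
      qed
      then show "0 \<in> V \<and> \<beta> 0 = ?T (b 0)"
        using subspace_0[OF V] by simp
      fix c x y assume x: "x \<in> C" and y: "y \<in> V \<and> \<beta> y = ?T (b y)"
      have xV: "x \<in> V" using x C by blast
      have *: "b (scale c x + y) d = c * b x d + b y d" if "d \<in> C" for d
      proof -
        have "linear_on V scale (*) (\<lambda>x. b x d)"
          using that C bil unfolding bilinear_on_def by blast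
        then show ?thesis using xV y subspace_scale[OF V xV, of c]
          unfolding linear_on_def by simp
      qed
      have "?T (b (scale c x + y)) = (\<Sum>d\<in>C. scale (c * b x d + b y d) d)"
        by (rule sum.cong) (use * in auto)
      also have "\<dots> = scale c (?T (b x)) + ?T (b y)"
        by (simp add: scale_left_distrib sum.distrib scale_sum_right)
      finally show "scale c x + y \<in> V \<and> \<beta> (scale c x + y) = ?T (b (scale c x + y))"
        using xV x y \<beta>(2)[OF x] subspace_add[OF V] subspace_scale[OF V]
        by (simp add: \<beta>.add \<beta>.scale)
    qed
    then show ?thesis by simp
  qed
  have lb: "linear_on V scale (*) (b x)" if "x \<in> V" for x
    using bil that unfolding bilinear_on_def by simp
  have "\<beta> ` span C = span C"
  proof (rule injective_image_spans[OF \<beta>(1) finC C(2)])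
    show "\<beta> ` span C \<subseteq> span C"
      using \<beta>_eq sp by (auto intro!: span_sum span_scale intro: span_base)
    fix x assume x: "x \<in> span C" "\<beta> x = 0"
    then have xV: "x \<in> V" using sp by simp
    have "b x c = 0" if "c \<in> C" for c
      using Tinj[of "b x" "\<lambda>_. 0" c] x(2) \<beta>_eq[OF xV] that by simp
    moreover have "linear_on V scale (*) (\<lambda>_. 0)" by (simp add: linear_on_def)
    ultimately have "\<forall>y\<in>V. b x y = 0"
      using agree lb[OF xV] by blast
    then show "x = 0" using nd xV by blast
  qed
  moreover have "?T f \<in> span C" by (intro span_sum span_scale) (auto intro: span_base)
  ultimately obtain y where y: "y \<in> V" "\<beta> y = ?T f" using sp by (metis imageE)
  then have "\<And>c. c \<in> C \<Longrightarrow> b y c = f c" using Tinj[of "b y" f] \<beta>_eq by simp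
  then show ?thesis using agree lb y(1) f by blast
qed

end

section \<open>Generalized eigenvectors of an endomorphism\<close>

locale endomorphism = vector_space scale
  for scale :: "'k::{alg_closed_field, field_char_0} \<Rightarrow> 'v::ab_group_add \<Rightarrow> 'v" +
  fixes \<delta> :: "'v \<Rightarrow> 'v"
  assumes linear: "Vector_Spaces.linear scale scale \<delta>"
begin

sublocale \<delta>: Vector_Spaces.linear scale scale \<delta> by (rule linear)

text \<open>
  The action \<open>p(\<delta>) v\<close> of a polynomial by Horner's scheme, which makes induction over \<open>pCons\<close> immediate.
\<close>

definition poly_act :: "'k poly \<Rightarrow> 'v \<Rightarrow> 'v" where
  "poly_act p v = fold_coeffs (\<lambda>a u. scale a v + \<delta> u) p 0"

lemma poly_act_0 [simp]: "poly_act 0 v = 0"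
  by (simp add: poly_act_def)

lemma poly_act_pCons [simp]: "poly_act (pCons a p) v = scale a v + \<delta> (poly_act p v)"
  by (cases "p = 0 \<and> a = 0") (auto simp: poly_act_def )

lemma poly_act_add: "poly_act (p + q) v = poly_act p v + poly_act q v"
  by (induction p q rule: poly_induct2) (simp_all add: scale_left_distrib \<delta>.add algebra_simps)

lemma poly_act_smult: "poly_act (smult c p) v = scale c (poly_act p v)"
  by (induction p) (simp_all add: scale_right_distrib \<delta>.scale)

lemma poly_act_mult: "poly_act (p * q) v = poly_act p (poly_act q v)"
  by (induction p) (simp_all add: poly_act_add poly_act_smult)

lemma poly_act_add_right: "poly_act p (v + w) = poly_act p v + poly_act p w"
  by (induction p) (simp_all add: scale_right_distrib \<delta>.add algebra_simps)

lemma poly_act_scale_right: "poly_act p (scale c v) = scale c (poly_act p v)"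
  by (induction p) (simp_all add: scale_right_distrib \<delta>.scale mult.commute)

lemma poly_act_zero_right [simp]: "poly_act p 0 = 0"
  by (induction p) (simp_all )

lemma poly_act_eigenvector: "\<delta> v = scale a v \<Longrightarrow> poly_act p v = scale (poly p a) v"
  by (induction p) (simp_all add: \<delta>.scale scale_left_distrib mult.commute)

lemma poly_act_monom: "poly_act (monom c n) v = scale c ((\<delta> ^^ n) v)"
  by (induction n) (simp_all add: monom_0 monom_Suc \<delta>.scale)

lemma poly_act_sum: "poly_act (\<Sum>i\<in>I. p i) v = (\<Sum>i\<in>I. poly_act (p i) v)"
  by (induction I rule: infinite_finite_induct) (simp_all add: poly_act_add)

text \<open>
  Among \<open>v, \<delta> v, \<delta>\<^sup>2 v, \<dots>\<close> more vectors than a spanning set has are dependent, and the relation is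
  a polynomial killing \<open>v\<close>; the product over a spanning set kills the whole subspace.
\<close>

lemma annihilating_poly_exists:
  assumes fin: "finite A" and inv: "\<delta> ` span A \<subseteq> span A"
  shows "\<exists>p. p \<noteq> 0 \<and> (\<forall>v\<in>span A. poly_act p v = 0)"
proof -
  have single: "\<exists>p. p \<noteq> 0 \<and> poly_act p v = 0" if v: "v \<in> span A" for v
  proof -
    have "(\<delta> ^^ i) v \<in> span A" for i
      by (induction i) (use v inv in auto)
    then obtain c i where c: "i \<le> card A" "c i \<noteq> 0"
        "(\<Sum>i\<le>card A. scale (c i) ((\<delta> ^^ i) v)) = 0"
      using linear_relation_exists[OF fin, of "\<lambda>i. (\<delta> ^^ i) v"] by blast
    let ?p = "\<Sum>i\<le>card A. monom (c i) i"
    have "coeff ?p i = c i" using c(1) by (simp add: coeff_sum if_distrib cong: if_cong)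
    then have "?p \<noteq> 0" using c(2) by (metis coeff_0)
    moreover have "poly_act ?p v = 0" using c(3) by (simp add: poly_act_sum poly_act_monom)
    ultimately show ?thesis by blast
  qed
  have "\<exists>p. p \<noteq> 0 \<and> (\<forall>v\<in>B. poly_act p v = 0)" if "finite B" "B \<subseteq> span A" for B
    using that
  proof (induction B)
    case (insert b B)
    then obtain p where p: "p \<noteq> 0" "\<forall>v\<in>B. poly_act p v = 0" by auto
    obtain q where q: "q \<noteq> 0" "poly_act q b = 0" using single insert.prems by auto
    have "poly_act (p * q) v = 0" if "v \<in> insert b B" for v
      using that p q by (metis insert_iff mult.commute poly_act_mult poly_act_zero_right)
    then show ?case using p q by (intro exI[of _ "p * q"]) auto
  qed (auto intro: exI[of _ 1])
  then obtain p where p: "p \<noteq> 0" "\<forall>v\<in>A. poly_act p v = 0"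
    using fin span_superset by blast
  have "poly_act p v = 0" if "v \<in> span A" for v
    using that
  proof (induction rule: span_induct_alt)
    case (step c x y)
    then show ?case using p by (simp add: poly_act_add_right poly_act_scale_right)
  qed simp
  then show ?thesis using p(1) by blast
qed

definition shift :: "'k \<Rightarrow> 'v \<Rightarrow> 'v" where
  "shift a v = \<delta> v - scale a v"

definition gen_eigen :: "'k \<Rightarrow> 'v \<Rightarrow> bool" where
  "gen_eigen a v \<longleftrightarrow> (\<exists>n. (shift a ^^ n) v = 0)"

lemma shift_add: "shift a (v + w) = shift a v + shift a w"
  by (simp add: shift_def \<delta>.add scale_right_distrib)

lemma shift_diff: "shift a (v - w) = shift a v - shift a w"
  by (simp add: shift_def \<delta>.diff scale_right_diff_distrib)

lemma shift_scale: "shift a (scale c v) = scale c (shift a v)"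
  by (simp add: shift_def \<delta>.scale scale_right_diff_distrib mult.commute)

lemma shift_0 [simp]: "shift a 0 = 0"
  by (simp add: shift_def )

lemma shift_pow_add: "(shift a ^^ n) (v + w) = (shift a ^^ n) v + (shift a ^^ n) w"
  by (induction n) (simp_all add: shift_add)

lemma shift_pow_scale: "(shift a ^^ n) (scale c v) = scale c ((shift a ^^ n) v)"
  by (induction n) (simp_all add: shift_scale)

lemma shift_pow_0 [simp]: "(shift a ^^ n) 0 = 0"
  by (induction n) simp_all

lemma shift_pow_mono:
  fixes n m :: nat
  assumes "(shift a ^^ n) v = 0" "n \<le> m" shows "(shift a ^^ m) v = 0"
proof -
  have "(shift a ^^ (m - n + n)) v = 0" unfolding funpow_add o_apply assms(1) by simp
  then show ?thesis using assms(2) by simp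
qed

lemma gen_eigen_add:
  assumes "gen_eigen a v" "gen_eigen a w" shows "gen_eigen a (v + w)"
proof -
  obtain n m where "(shift a ^^ n) v = 0" "(shift a ^^ m) w = 0"
    using assms unfolding gen_eigen_def by blast
  then have "(shift a ^^ max n m) (v + w) = 0"
    unfolding shift_pow_add by (simp add: shift_pow_mono)
  then show ?thesis unfolding gen_eigen_def by blast
qed

lemma gen_eigen_scale: "gen_eigen a v \<Longrightarrow> gen_eigen a (scale c v)"
  unfolding gen_eigen_def shift_pow_scale by (metis scale_zero_right)

lemma gen_eigen_0 [simp]: "gen_eigen a 0"
  unfolding gen_eigen_def by simp

lemma gen_eigen_shift_iff: "gen_eigen a (shift a v) \<longleftrightarrow> gen_eigen a v"
proof -
  have "(shift a ^^ n) (shift a v) = (shift a ^^ Suc n) v" for n by (simp add: funpow_swap1)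
  moreover have "(shift a ^^ n) v = 0 \<Longrightarrow> (shift a ^^ Suc n) v = 0" for n by simp
  ultimately show ?thesis unfolding gen_eigen_def by metis
qed

lemma shift_in: "subspace N \<Longrightarrow> \<delta> ` N \<subseteq> N \<Longrightarrow> v \<in> N \<Longrightarrow> shift a v \<in> N"
  unfolding shift_def by (intro subspace_diff subspace_scale) auto

text \<open>
  On the generalized eigenspace of \<open>b \<noteq> a\<close> the operator \<open>\<delta> - a\<close> is the nonzero scalar \<open>b - a\<close> plus a
  nilpotent one, so it can be inverted; the induction unrolls the geometric series.
\<close>

lemma shift_surj_other_eigenvalue:
  assumes N: "subspace N" "\<delta> ` N \<subseteq> N" and ab: "a \<noteq> b" and u: "u \<in> N" "gen_eigen b u"
  shows "\<exists>t\<in>N. gen_eigen b t \<and> u = shift a t"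
proof -
  have "\<exists>t\<in>N. gen_eigen b t \<and> u = shift a t" if "(shift b ^^ n) u = 0" "u \<in> N" for n u
    using that
  proof (induction n arbitrary: u)
    case 0
    then show ?case using subspace_0[OF N(1)] by (intro bexI[of _ 0]) auto
  next
    case (Suc n)
    let ?c = "inverse (b - a)"
    have c: "?c * (b - a) = 1" using ab by simp
    have "gen_eigen b u" using Suc.prems unfolding gen_eigen_def by blast
    have "(shift b ^^ n) (shift b u) = 0" using Suc.prems(1) by (simp add: funpow_swap1)
    then obtain t where t: "t \<in> N" "gen_eigen b t" "shift b u = shift a t"
      using Suc.IH shift_in[OF N Suc.prems(2)] by metis
    let ?t = "scale ?c (u - t)"
    have "u = scale (?c * (b - a)) u" using c by simp
    also have "\<dots> = scale ?c (shift a u - shift b u)"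
      by (simp add: shift_def scale_right_diff_distrib scale_left_diff_distrib right_diff_distrib)
    also have "\<dots> = shift a ?t" unfolding t(3) shift_scale shift_diff ..
    finally have "u = shift a ?t" .
    moreover have "?t \<in> N" using t(1) Suc.prems(2) N(1) by (intro subspace_scale subspace_diff)
    moreover have "gen_eigen b (u + scale (-1) t)"
      using \<open>gen_eigen b u\<close> t(2) by (intro gen_eigen_add gen_eigen_scale)
    then have "gen_eigen b ?t" by (intro gen_eigen_scale) simp
    ultimately show ?case by blast
  qed
  then show ?thesis using u unfolding gen_eigen_def by blast
qed

text \<open>
  Generalized eigenvectors span every subspace stable under \<open>\<delta>\<close>.  If \<open>a\<close> is a root of \<open>p\<close>, the vector
  \<open>(\<delta> - a) w\<close> is killed by a polynomial of smaller degree and hence decomposes.  The components of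
  weight different from \<open>a\<close> can be divided by \<open>\<delta> - a\<close>, and what is then left of \<open>w\<close> is a generalized
  eigenvector of weight \<open>a\<close>.
\<close>

lemma in_span_gen_eigen:
  assumes N: "subspace N" "\<delta> ` N \<subseteq> N" and p: "p \<noteq> 0" "poly_act p w = 0" and w: "w \<in> N"
  shows "w \<in> span {v \<in> N. \<exists>a. gen_eigen a v}"
  using p w
proof (induction "degree p" arbitrary: p w)
  case 0
  obtain c where "p = [:c:]" using "0.hyps" by (metis degree_eq_zeroE)
  then have "w = 0" using 0 by (simp )
  then show ?case by (simp add: span_zero)
next
  case (Suc d)
  let ?G = "{v \<in> N. \<exists>a. gen_eigen a v}"
  obtain a where "poly p a = 0" using alg_closed_imp_poly_has_root[of p] Suc.hyps(2) by auto
  then obtain q where q: "p = [:-a, 1:] * q" using poly_eq_0_iff_dvd by (metis dvdE)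
  have q0: "q \<noteq> 0" using q Suc.prems by auto
  then have "d = degree q" using Suc.hyps(2) unfolding q by (subst (asm) degree_mult_eq) auto
  moreover have "poly_act [:-a, 1:] w = shift a w" by (simp add: shift_def )
  then have "poly_act q (shift a w) = 0"
    using Suc.prems(2) unfolding q by (metis mult.commute poly_act_mult)
  ultimately have "shift a w \<in> span ?G"
    using Suc.hyps(1)[OF _ q0] shift_in[OF N Suc.prems(3)] by blast
  then have "\<exists>t s. t \<in> span ?G \<and> s \<in> N \<and> gen_eigen a s \<and> shift a w = shift a t + s"
  proof (induction rule: span_induct_alt)
    case base
    show ?case using subspace_0[OF N(1)] by (intro exI[of _ 0]) (auto simp: span_zero)
  next
    case (step c x y)
    then obtain t s where ts: "t \<in> span ?G" "s \<in> N" "gen_eigen a s" "y = shift a t + s" by blast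
    obtain b where b: "x \<in> N" "gen_eigen b x" using step by blast
    show ?case
    proof (cases "b = a")
      case True
      then have "scale c x + y = shift a t + (scale c x + s)" using ts(4) by simp
      moreover have "scale c x + s \<in> N" using b(1) ts(2) N(1) by (intro subspace_add subspace_scale)
      moreover have "gen_eigen a (scale c x + s)"
        using b(2) ts(3) True by (auto intro: gen_eigen_add gen_eigen_scale)
      ultimately show ?thesis using ts(1) by blast
    next
      case False
      then obtain t' where t': "t' \<in> N" "gen_eigen b t'" "x = shift a t'"
        using shift_surj_other_eigenvalue[OF N _ b] by metis
      then have "scale c x + y = shift a (scale c t' + t) + s"
        using ts(4) by (simp add: shift_add shift_scale)
      moreover have "scale c t' + t \<in> span ?G"
        using t' ts(1) by (intro span_add span_scale) (auto intro: span_base)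
      ultimately show ?thesis using ts(2,3) by blast
    qed
  qed
  then obtain t s where ts: "t \<in> span ?G" "s \<in> N" "gen_eigen a s" "shift a w = shift a t + s"
    by blast
  have "span ?G \<subseteq> N" using N(1) by (intro span_minimal) auto
  then have "w - t \<in> N" using ts(1) Suc.prems(3) N(1) by (intro subspace_diff) auto
  moreover have "gen_eigen a (w - t)"
    using ts(3,4) gen_eigen_shift_iff[of a "w - t"] by (simp add: shift_diff)
  ultimately have "w - t \<in> span ?G" by (intro span_base) auto
  then have "t + (w - t) \<in> span ?G" using ts(1) by (rule span_add[rotated])
  then show ?case by simp
qed

text \<open>
  The last nonzero vector among \<open>v, (\<delta> - a) v, (\<delta> - a)\<^sup>2 v, \<dots>\<close> is a true eigenvector, on which \<open>p(\<delta>)\<close>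
  acts as the scalar \<open>p(a)\<close>.  So only the roots of an annihilating polynomial occur as weights.
\<close>

lemma gen_eigen_root:
  assumes V: "subspace V" "\<delta> ` V \<subseteq> V" and p: "\<forall>v\<in>V. poly_act p v = 0"
    and v: "v \<in> V" "v \<noteq> 0" "gen_eigen a v"
  shows "poly p a = 0"
proof -
  obtain n where "(shift a ^^ n) v = 0" using v(3) unfolding gen_eigen_def by blast
  then show ?thesis using v(1,2)
  proof (induction n arbitrary: v)
    case (Suc n)
    show ?case
    proof (cases "shift a v = 0")
      case True
      then have "poly_act p v = scale (poly p a) v"
        by (intro poly_act_eigenvector) (simp add: shift_def)
      then show ?thesis using p Suc.prems by simp
    next
      case False
      then show ?thesis using Suc.IH[of "shift a v"] Suc.prems shift_in[OF V]
        by (simp add: funpow_swap1)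
    qed
  qed simp
qed

lemma gen_eigen_imp_eigenvector:
  assumes N: "subspace N" "\<delta> ` N \<subseteq> N" and v: "v \<in> N" "v \<notin> U" "gen_eigen a v" and U: "0 \<in> U"
  shows "\<exists>w\<in>N. w \<notin> U \<and> gen_eigen a w \<and> shift a w \<in> U"
proof -
  obtain n where "(shift a ^^ n) v = 0" using v(3) unfolding gen_eigen_def by blast
  then show ?thesis using v(1,2)
  proof (induction n arbitrary: v)
    case 0 then show ?case using U by simp
  next
    case (Suc n)
    show ?case
    proof (cases "shift a v \<in> U")
      case True
      then show ?thesis using Suc.prems unfolding gen_eigen_def by blast
    next
      case False
      then show ?thesis using Suc.IH[of "shift a v"] Suc.prems shift_in[OF N]
        by (simp add: funpow_swap1)
    qed
  qed
qed

text \<open>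
  A lift of an eigenvector of \<open>\<delta>\<close> on the quotient \<open>N / U\<close> that is also a generalized eigenvector of
  \<open>\<delta>\<close> itself.  Both properties matter when a \<open>\<delta>\<close>-stable subalgebra \<open>U\<close> is enlarged: the first keeps
  it \<open>\<delta>\<close>-stable, the second makes the new element act nilpotently.
\<close>

lemma gen_eigen_outside:
  assumes N: "subspace N" "\<delta> ` N \<subseteq> N" and U: "subspace U" "w \<in> N" "w \<notin> U"
    and fin: "finite A" "N \<subseteq> span A" "\<delta> ` span A \<subseteq> span A"
  shows "\<exists>v\<in>N. \<exists>a. v \<notin> U \<and> gen_eigen a v \<and> shift a v \<in> U"
proof -
  obtain p where p: "p \<noteq> 0" "\<forall>v\<in>span A. poly_act p v = 0"
    using annihilating_poly_exists[OF fin(1,3)] by blast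
  then have "w \<in> span {v \<in> N. \<exists>a. gen_eigen a v}"
    using in_span_gen_eigen[OF N] U(2) fin(2) by blast
  then have "\<not> {v \<in> N. \<exists>a. gen_eigen a v} \<subseteq> U"
    using U(1,3) span_minimal by blast
  then obtain v a where "v \<in> N" "v \<notin> U" "gen_eigen a v" by blast
  then show ?thesis using gen_eigen_imp_eigenvector[OF N] subspace_0[OF U(1)] by blast
qed

end

section \<open>Lie algebras with an injective derivation\<close>

locale lie_algebra_derivation = endomorphism scale \<delta>
  for scale :: "'k::{alg_closed_field, field_char_0} \<Rightarrow> 'v::ab_group_add \<Rightarrow> 'v" and \<delta> +
  fixes V :: "'v set" and br :: "'v \<Rightarrow> 'v \<Rightarrow> 'v" and A :: "'v set"
  assumes finite_A: "finite A" and V_span: "V = span A"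
    and br_closed: "\<lbrakk>x \<in> V; y \<in> V\<rbrakk> \<Longrightarrow> br x y \<in> V"
    and br_add_right: "\<lbrakk>x \<in> V; y \<in> V; z \<in> V\<rbrakk> \<Longrightarrow> br x (y + z) = br x y + br x z"
    and br_scale_right: "\<lbrakk>x \<in> V; y \<in> V\<rbrakk> \<Longrightarrow> br x (scale c y) = scale c (br x y)"
    and br_skew: "\<lbrakk>x \<in> V; y \<in> V\<rbrakk> \<Longrightarrow> br x y = - br y x"
    and jacobi: "\<lbrakk>x \<in> V; y \<in> V; z \<in> V\<rbrakk> \<Longrightarrow> br x (br y z) = br (br x y) z + br y (br x z)"
    and \<delta>_closed: "\<delta> ` V \<subseteq> V"
    and derivation: "\<lbrakk>x \<in> V; y \<in> V\<rbrakk> \<Longrightarrow> \<delta> (br x y) = br (\<delta> x) y + br x (\<delta> y)"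
    and \<delta>_inj: "\<lbrakk>x \<in> V; \<delta> x = 0\<rbrakk> \<Longrightarrow> x = 0"
begin

lemma V_subspace: "subspace V"
  unfolding V_span by simp

lemmas V_closed = subspace_0[OF V_subspace] subspace_add[OF V_subspace]
  subspace_scale[OF V_subspace] subspace_diff[OF V_subspace] subspace_neg[OF V_subspace]

lemma br_add_left: "\<lbrakk>x \<in> V; y \<in> V; z \<in> V\<rbrakk> \<Longrightarrow> br (x + y) z = br x z + br y z"
  using br_skew[of "x + y" z] br_skew[of x z] br_skew[of y z] br_add_right[of z x y]
  by (simp add: V_closed)

lemma br_scale_left: "\<lbrakk>x \<in> V; y \<in> V\<rbrakk> \<Longrightarrow> br (scale c x) y = scale c (br x y)"
  using br_skew[of "scale c x" y] br_skew[of x y] br_scale_right[of y x c]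
  by (simp add: V_closed)

lemma br_zero_right [simp]: "x \<in> V \<Longrightarrow> br x 0 = 0"
  using br_scale_right[of x 0 0] V_closed(1) by simp

lemma br_zero_left [simp]: "x \<in> V \<Longrightarrow> br 0 x = 0"
  using br_scale_left[of 0 x 0] V_closed(1) by simp

lemma br_diff_right: "\<lbrakk>x \<in> V; y \<in> V; z \<in> V\<rbrakk> \<Longrightarrow> br x (y - z) = br x y - br x z"
  using br_add_right[of x y "- z"] br_scale_right[of x z "-1"] by (simp add: V_closed)

lemma br_diff_left: "\<lbrakk>x \<in> V; y \<in> V; z \<in> V\<rbrakk> \<Longrightarrow> br (x - y) z = br x z - br y z"
  using br_add_left[of x "- y" z] br_scale_left[of y z "-1"] by (simp add: V_closed)

lemma br_self [simp]:
  assumes "x \<in> V" shows "br x x = 0"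
proof -
  have "br x x + br x x = 0"
    using br_skew[OF assms assms] by (simp only: eq_neg_iff_add_eq_0)
  then have "scale (1 + 1) (br x x) = 0" unfolding scale_left_distrib by simp
  then show ?thesis by simp
qed

lemma shift_V: "v \<in> V \<Longrightarrow> shift a v \<in> V"
  by (rule shift_in[OF V_subspace \<delta>_closed])

lemma shift_br:
  assumes "x \<in> V" "y \<in> V"
  shows "shift (a + b) (br x y) = br (shift a x) y + br x (shift b y)"
proof -
  have "\<delta> x \<in> V" "\<delta> y \<in> V" using assms \<delta>_closed by auto
  then show ?thesis using assms
    by (simp add: shift_def derivation br_diff_left br_diff_right br_scale_left br_scale_right
        V_closed scale_left_distrib)
qed

text \<open>
  Brackets add weights: by the derivation rule, \<open>\<delta> - (a + b)\<close> applied to \<open>[x,y]\<close> lowers either the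
  nilpotency order of \<open>x\<close> or that of \<open>y\<close>.
\<close>

lemma gen_eigen_br:
  assumes "gen_eigen a x" "gen_eigen b y" "x \<in> V" "y \<in> V"
  shows "gen_eigen (a + b) (br x y)"
proof -
  have "gen_eigen (a + b) (br x y)"
    if "(shift a ^^ n) x = 0" "(shift b ^^ m) y = 0" "x \<in> V" "y \<in> V" for n m
    using that
  proof (induction "n + m" arbitrary: n m x y rule: less_induct)
    case less
    show ?case
    proof (cases n)
      case 0
      then show ?thesis using less.prems by simp
    next
      case n: (Suc n')
      show ?thesis
      proof (cases m)
        case 0
        then show ?thesis using less.prems by simp
      next
        case m: (Suc m')
        have "gen_eigen (a + b) (br (shift a x) y)"
          by (rule less.hyps[of n' m]) (use less.prems n shift_V in \<open>auto simp: funpow_swap1\<close>)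
        moreover have "gen_eigen (a + b) (br x (shift b y))"
          by (rule less.hyps[of n m']) (use less.prems m shift_V in \<open>auto simp: funpow_swap1\<close>)
        ultimately have "gen_eigen (a + b) (shift (a + b) (br x y))"
          using less.prems by (simp add: shift_br gen_eigen_add)
        then show ?thesis by (simp add: gen_eigen_shift_iff)
      qed
    qed
  qed
  then show ?thesis using assms unfolding gen_eigen_def by blast
qed

lemma gen_eigen_nonzero:
  assumes "gen_eigen 0 x" "x \<in> V" shows "x = 0"
proof -
  have "x = 0" if "(\<delta> ^^ n) x = 0" "x \<in> V" for n
    using that
  proof (induction n arbitrary: x)
    case (Suc n)
    then have "\<delta> x = 0" using \<delta>_closed by (auto simp: funpow_swap1)
    then show ?case using \<delta>_inj Suc.prems by simp
  qed simp
  moreover have "shift 0 = \<delta>" by (auto simp: shift_def)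
  ultimately show ?thesis using assms unfolding gen_eigen_def by auto
qed

lemma br_pow_closed: "v \<in> V \<Longrightarrow> y \<in> V \<Longrightarrow> (br v ^^ n) y \<in> V"
  by (induction n) (auto intro: br_closed)

lemma br_pow_add: "v \<in> V \<Longrightarrow> y \<in> V \<Longrightarrow> z \<in> V \<Longrightarrow> (br v ^^ n) (y + z) = (br v ^^ n) y + (br v ^^ n) z"
  by (induction n) (simp_all add: br_add_right br_pow_closed)

lemma br_pow_scale: "v \<in> V \<Longrightarrow> y \<in> V \<Longrightarrow> (br v ^^ n) (scale c y) = scale c ((br v ^^ n) y)"
  by (induction n) (simp_all add: br_scale_right br_pow_closed)

lemma br_pow_mono:
  assumes "v \<in> V" "(br v ^^ n) y = 0" "n \<le> m" shows "(br v ^^ m) y = 0"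
proof -
  have "(br v ^^ k) 0 = 0" for k by (induction k) (use assms(1) in auto)
  then have "(br v ^^ (m - n + n)) y = 0" unfolding funpow_add o_apply assms(2) by simp
  then show ?thesis using assms(3) by simp
qed

text \<open>
  Applying \<open>ad v\<close> repeatedly moves a vector of weight \<open>b\<close> through the weights \<open>b + n a\<close>.  Since \<open>\<delta>\<close> is
  injective, \<open>a \<noteq> 0\<close>, and in characteristic zero these are infinitely many scalars, whereas only
  finitely many of them are weights.
\<close>

lemma ad_gen_eigen_nilpotent:
  assumes v: "v \<in> V" "gen_eigen a v" and y: "y \<in> V"
  shows "\<exists>n. (br v ^^ n) y = 0"
proof (cases "v = 0")
  case True
  then show ?thesis using y by (intro exI[of _ 1]) simp
next
  case False
  then have a: "a \<noteq> 0" using v gen_eigen_nonzero by metis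
  obtain p where p: "p \<noteq> 0" "\<forall>v\<in>V. poly_act p v = 0"
    using annihilating_poly_exists[OF finite_A] \<delta>_closed unfolding V_span by blast
  have gen: "\<exists>n. (br v ^^ n) y = 0" if y: "y \<in> V" "gen_eigen b y" for y b
  proof (rule ccontr)
    assume no: "\<not> ?thesis"
    have "gen_eigen (of_nat n * a + b) ((br v ^^ n) y)" for n
    proof (induction n)
      case (Suc n)
      then show ?case using gen_eigen_br[OF v(2) Suc v(1) br_pow_closed[OF v(1) y(1)]]
        by (simp add: algebra_simps)
    qed (use y in simp)
    then have "poly p (of_nat n * a + b) = 0" for n
      using gen_eigen_root[OF V_subspace \<delta>_closed p(2) br_pow_closed[OF v(1) y(1)]] no by blast
    then have "range (\<lambda>n. of_nat n * a + b) \<subseteq> {x. poly p x = 0}" by auto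
    then have "finite (range (\<lambda>n. of_nat n * a + b))"
      using poly_roots_finite[OF p(1)] finite_subset by blast
    moreover have "inj (\<lambda>n. of_nat n * a + b)" using a by (auto simp: inj_def)
    ultimately show False using finite_imageD by blast
  qed
  have "y \<in> span {v \<in> V. \<exists>a. gen_eigen a v}"
    using in_span_gen_eigen[OF V_subspace \<delta>_closed p(1)] p(2) y by blast
  then have "y \<in> V \<and> (\<exists>n. (br v ^^ n) y = 0)"
  proof (induction rule: span_induct_alt)
    case base
    show ?case using V_closed(1) by (auto intro: exI[of _ 0])
  next
    case (step c x y)
    then obtain n m where nm: "(br v ^^ n) x = 0" "(br v ^^ m) y = 0" using gen by blast
    have "(br v ^^ max n m) x = 0" "(br v ^^ max n m) y = 0"
      using nm v(1) br_pow_mono by (meson max.cobounded1 max.cobounded2)+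
    then have "(br v ^^ max n m) (scale c x + y) = 0"
      using step v(1) by (simp add: br_pow_add br_pow_scale V_closed)
    then show ?case using step by (auto simp: V_closed)
  qed
  then show ?thesis by blast
qed

text \<open>
  The conclusion of Engel's theorem for \<open>U\<close>, demanded of every subquotient \<open>N / M\<close> of the adjoint
  module and not only of the algebra: in this form it passes from a subalgebra to a larger one.
\<close>

definition acts_nilpotently :: "'v set \<Rightarrow> bool" where
  "acts_nilpotently U \<longleftrightarrow>
     (\<forall>M N. subspace M \<longrightarrow> subspace N \<longrightarrow> M \<subset> N \<longrightarrow> N \<subseteq> V \<longrightarrow>
        (\<forall>u\<in>U. \<forall>w\<in>M. br u w \<in> M) \<longrightarrow> (\<forall>u\<in>U. \<forall>w\<in>N. br u w \<in> N) \<longrightarrow>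
        (\<exists>w\<in>N. w \<notin> M \<and> (\<forall>u\<in>U. br u w \<in> M)))"

definition nil_subalgebra :: "'v set \<Rightarrow> bool" where
  "nil_subalgebra U \<longleftrightarrow> subspace U \<and> U \<subseteq> V \<and> \<delta> ` U \<subseteq> U \<and> (\<forall>u\<in>U. \<forall>w\<in>U. br u w \<in> U) \<and>
     acts_nilpotently U"

lemma acts_nilpotentlyD:
  assumes "acts_nilpotently U" "subspace M" "subspace N" "M \<subseteq> N" "w \<in> N" "w \<notin> M" "N \<subseteq> V"
    "\<And>u w. u \<in> U \<Longrightarrow> w \<in> M \<Longrightarrow> br u w \<in> M" "\<And>u w. u \<in> U \<Longrightarrow> w \<in> N \<Longrightarrow> br u w \<in> N"
  shows "\<exists>w\<in>N. w \<notin> M \<and> (\<forall>u\<in>U. br u w \<in> M)"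
proof -
  have "M \<subset> N" using assms by blast
  then show ?thesis using assms unfolding acts_nilpotently_def by simp
qed

lemma nil_subalgebra_zero: "nil_subalgebra {0}"
proof -
  have "acts_nilpotently {0}"
    unfolding acts_nilpotently_def
  proof (intro allI impI)
    fix M N assume "subspace M" "M \<subset> N" "N \<subseteq> V"
    then obtain w where "w \<in> N" "w \<notin> M" "w \<in> V" by blast
    then show "\<exists>w\<in>N. w \<notin> M \<and> (\<forall>u\<in>{0}. br u w \<in> M)"
      using subspace_0[OF \<open>subspace M\<close>] by (intro bexI[of _ w]) auto
  qed
  then show ?thesis
    unfolding nil_subalgebra_def using V_closed(1) by (auto simp: \<delta>.zero)
qed

text \<open>
  The induction step of Engel's theorem.  Nilpotency of the action on \<open>V / U\<close> makes the normalizer of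
  \<open>U\<close> strictly larger than \<open>U\<close>; it is stable under \<open>\<delta>\<close>, so it contains a suitable generalized
  eigenvector \<open>v\<close> outside \<open>U\<close>.  On a subquotient, the vectors killed by \<open>U\<close> form a nonzero space that
  \<open>v\<close> preserves because it normalizes \<open>U\<close>, and the nilpotent \<open>ad v\<close> has a kernel there.
\<close>

lemma nil_subalgebra_extend:
  assumes U: "nil_subalgebra U" and ne: "U \<noteq> V"
  obtains v where "v \<in> V" "v \<notin> U" "nil_subalgebra (span (insert v U))"
proof -
  have sU: "subspace U" and UV: "U \<subseteq> V" and dU: "\<delta> ` U \<subseteq> U"
    and cU: "\<And>u w. u \<in> U \<Longrightarrow> w \<in> U \<Longrightarrow> br u w \<in> U" and nU: "acts_nilpotently U"
    using U unfolding nil_subalgebra_def by auto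
  note U_closed = subspace_0[OF sU] subspace_add[OF sU] subspace_scale[OF sU] subspace_diff[OF sU]
  define N where "N = {w \<in> V. \<forall>u\<in>U. br u w \<in> U}"
  have sN: "subspace N"
    unfolding N_def subspace_def using UV
    by (auto simp: V_closed br_add_right br_scale_right U_closed subset_iff)
  obtain x where "x \<in> V" "x \<notin> U" using ne UV by blast
  then have "\<exists>w\<in>V. w \<notin> U \<and> (\<forall>u\<in>U. br u w \<in> U)"
    using UV cU br_closed by (intro acts_nilpotentlyD[OF nU sU V_subspace UV]) auto
  then obtain w where w: "w \<in> N" "w \<notin> U" unfolding N_def by blast
  have "\<delta> ` N \<subseteq> N"
  proof safe
    fix w assume w: "w \<in> N"
    have "br u (\<delta> w) \<in> U" if "u \<in> U" for u
    proof -
      have "br u (\<delta> w) = \<delta> (br u w) - br (\<delta> u) w"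
        using that w UV derivation[of u w] unfolding N_def by auto
      then show ?thesis using that w dU unfolding N_def by (auto intro!: U_closed(4))
    qed
    then show "\<delta> w \<in> N" using w \<delta>_closed unfolding N_def by auto
  qed
  then obtain v a where v: "v \<in> N" "v \<notin> U" "gen_eigen a v" "shift a v \<in> U"
    using gen_eigen_outside[OF sN _ sU w finite_A] \<delta>_closed unfolding N_def V_span by blast
  have vV: "v \<in> V" and vU: "\<And>u. u \<in> U \<Longrightarrow> br u v \<in> U" using v(1) unfolding N_def by auto
  have vU': "br v u \<in> U" if "u \<in> U" for u
    using br_skew[OF vV, of u] vU[OF that] that UV subspace_neg[OF sU] by auto
  have mem: "x \<in> span (insert v U) \<longleftrightarrow> (\<exists>k. x - scale k v \<in> U)" for x
    using sU by (simp add: span_breakdown_eq flip: span_eq_iff)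
  have spE: "\<exists>c u. u \<in> U \<and> x = scale c v + u" if "x \<in> span (insert v U)" for x
    using that unfolding mem by (metis add.commute diff_add_cancel)
  have spI: "scale c v + u \<in> span (insert v U)" if "u \<in> U" for c u
    using that unfolding mem by (intro exI[of _ c]) simp
  let ?W = "span (insert v U)"
  have WV: "?W \<subseteq> V" using vV UV by (intro span_minimal V_subspace) auto
  have UW: "U \<subseteq> ?W" by (meson span_superset subset_insertI subset_trans)
  have "\<delta> ` ?W \<subseteq> ?W"
  proof safe
    fix x assume "x \<in> ?W"
    then obtain c u where x: "u \<in> U" "x = scale c v + u" using spE by blast
    have "\<delta> x = scale (c * a) v + (scale c (shift a v) + \<delta> u)"
      using x by (simp add: \<delta>.add \<delta>.scale shift_def scale_right_diff_distrib)
    moreover have "scale c (shift a v) + \<delta> u \<in> U" using x v(4) dU by (auto intro!: U_closed)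
    ultimately show "\<delta> x \<in> ?W" using spI by simp
  qed
  moreover have "br x y \<in> ?W" if xy: "x \<in> ?W" "y \<in> ?W" for x y
  proof -
    obtain c u where x: "u \<in> U" "x = scale c v + u" using spE xy by blast
    obtain d w where y: "w \<in> U" "y = scale d v + w" using spE xy by blast
    have uV: "u \<in> V" "w \<in> V" using x y UV by auto
    have "br x y = scale c (br v w) + scale d (br u v) + br u w"
      using x y uV vV by (simp add: br_add_left br_add_right br_scale_left br_scale_right V_closed br_closed)
    moreover have "\<dots> \<in> U"
      using x y vU vU' cU by (intro U_closed) auto
    ultimately show ?thesis using UW by auto
  qed
  moreover have "acts_nilpotently ?W"
    unfolding acts_nilpotently_def
  proof (intro allI impI)
    fix M N assume M: "subspace M" and N: "subspace N" and MN: "M \<subset> N" and NV: "N \<subseteq> V"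
      and stM: "\<forall>u\<in>?W. \<forall>w\<in>M. br u w \<in> M" and stN: "\<forall>u\<in>?W. \<forall>w\<in>N. br u w \<in> N"
    have vW: "v \<in> ?W" by (simp add: span_base)
    obtain x where "x \<in> N" "x \<notin> M" using MN by blast
    then have "\<exists>w\<in>N. w \<notin> M \<and> (\<forall>u\<in>U. br u w \<in> M)"
      using MN stM stN UW by (intro acts_nilpotentlyD[OF nU M N _ _ _ NV]) auto
    then obtain w where w: "w \<in> N" "w \<notin> M" "\<And>u. u \<in> U \<Longrightarrow> br u w \<in> M" by blast
    obtain n where "(br v ^^ n) w = 0" using ad_gen_eigen_nilpotent[OF vV v(3)] w NV by blast
    then have "(br v ^^ n) w \<in> M" using subspace_0[OF M] by simp
    \<comment> \<open>apply \<open>ad v\<close> to \<open>w\<close> until the next step would fall into \<open>M\<close>\<close>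
    then have "\<exists>z\<in>N. z \<notin> M \<and> (\<forall>u\<in>U. br u z \<in> M) \<and> br v z \<in> M"
      using w
    proof (induction n arbitrary: w)
      case (Suc n)
      show ?case
      proof (cases "br v w \<in> M")
        case True
        then show ?thesis using Suc.prems by blast
      next
        case False
        have "br u (br v w) \<in> M" if u: "u \<in> U" for u
        proof -
          have "br u (br v w) = br (br u v) w + br v (br u w)"
            using jacobi u vV Suc.prems(2) NV UV by blast
          moreover have "br (br u v) w \<in> M" using Suc.prems(4) vU u by blast
          moreover have "br v (br u w) \<in> M" using Suc.prems(4) stM vW u by blast
          ultimately show ?thesis using subspace_add[OF M] by simp
        qed
        moreover have "br v w \<in> N" using stN vW Suc.prems(2) by blast
        moreover have "(br v ^^ n) (br v w) \<in> M" using Suc.prems(1) by (simp add: funpow_swap1)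
        ultimately show ?thesis using Suc.IH False by blast
      qed
    qed simp
    then obtain z where z: "z \<in> N" "z \<notin> M" "\<And>u. u \<in> U \<Longrightarrow> br u z \<in> M" "br v z \<in> M" by blast
    have "br x z \<in> M" if x: "x \<in> ?W" for x
    proof -
      obtain c u where x: "u \<in> U" "x = scale c v + u" using spE x by blast
      have "br x z = scale c (br v z) + br u z"
        using x z(1) NV UV vV by (auto simp: br_add_left br_scale_left V_closed subset_iff)
      then show ?thesis using z x(1) M by (simp add: subspace_add subspace_scale)
    qed
    then show "\<exists>w\<in>N. w \<notin> M \<and> (\<forall>u\<in>?W. br u w \<in> M)" using z by blast
  qed
  ultimately have "nil_subalgebra ?W"
    unfolding nil_subalgebra_def using WV by simp
  then show thesis using that vV v(2) by blast
qed

text \<open>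
  A nil subalgebra of maximal dimension cannot be extended.  Dimension is measured by the size of an
  independent generating set.
\<close>

lemma whole_algebra_nil: "nil_subalgebra V"
proof -
  define Q where "Q n \<longleftrightarrow> (\<exists>B. independent B \<and> card B = n \<and> nil_subalgebra (span B))" for n
  have "Q 0" unfolding Q_def
    using nil_subalgebra_zero independent_empty by (intro exI[of _ "{}"]) simp
  moreover have bound: "finite B \<and> card B \<le> card A" if "independent B" "nil_subalgebra (span B)" for B
  proof -
    have "span B \<subseteq> V" using that(2) unfolding nil_subalgebra_def by simp
    then have "B \<subseteq> span A" using span_superset[of B] V_span by simp
    then show ?thesis by (rule independent_span_bound[OF finite_A that(1)])
  qed
  then have "\<forall>n. Q n \<longrightarrow> n \<le> card A" unfolding Q_def by auto
  ultimately have n: "Q (Greatest Q)" "\<And>m. Q m \<Longrightarrow> m \<le> Greatest Q"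
    by (auto intro: GreatestI_nat Greatest_le_nat)
  define n where "n = Greatest Q"
  note n = n[folded n_def]
  then obtain B where B: "independent B" "card B = n" "nil_subalgebra (span B)"
    using n(1) unfolding Q_def by auto
  have "span B = V"
  proof (rule ccontr)
    assume "span B \<noteq> V"
    then obtain v where v: "v \<notin> span B" "nil_subalgebra (span (insert v (span B)))"
      using nil_subalgebra_extend[OF B(3)] by blast
    have "span (insert v (span B)) = span (insert v B)"
      by (simp add: span_insert span_span)
    then have "nil_subalgebra (span (insert v B))" using v(2) by simp
    moreover have "independent (insert v B)" using v(1) B(1) by (rule independent_insertI)
    moreover have "card (insert v B) = Suc n"
      using bound[OF B(1,3)] v(1) B(2) span_superset by (metis card_insert_disjoint subsetD)
    ultimately have "Q (Suc n)" unfolding Q_def by blast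
    then show False using n(2) by fastforce
  qed
  then show ?thesis using B(3) by simp
qed

text \<open>
  Engel's conclusion for the whole algebra on the subquotient \<open>V / 0\<close> says that the centre is nonzero;
  the centre is stable under \<open>\<delta>\<close> and therefore contains an eigenvector.
\<close>

theorem central_eigenvector_exists:
  assumes "V \<noteq> {0}"
  shows "\<exists>z\<in>V. \<exists>a. z \<noteq> 0 \<and> a \<noteq> 0 \<and> \<delta> z = scale a z \<and> (\<forall>x\<in>V. br x z = 0)"
proof -
  define Z where "Z = {z \<in> V. \<forall>x\<in>V. br x z = 0}"
  have sZ: "subspace Z"
    unfolding Z_def subspace_def by (auto simp: V_closed br_add_right br_scale_right)
  have dZ: "\<delta> ` Z \<subseteq> Z"
  proof safe
    fix z assume z: "z \<in> Z"
    have "br x (\<delta> z) = 0" if "x \<in> V" for x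
    proof -
      have "\<delta> x \<in> V" using that \<delta>_closed by auto
      then show ?thesis using derivation[of x z] z that unfolding Z_def by (auto simp: \<delta>.zero)
    qed
    then show "\<delta> z \<in> Z" using z \<delta>_closed unfolding Z_def by auto
  qed
  obtain x where "x \<in> V" "x \<notin> {0}" using assms V_closed(1) by blast
  then have "\<exists>w\<in>V. w \<notin> {0} \<and> (\<forall>u\<in>V. br u w \<in> {0})"
    using whole_algebra_nil V_closed(1) br_closed unfolding nil_subalgebra_def
    by (intro acts_nilpotentlyD[of V "{0}" V x] V_subspace subspace_single_0) auto
  then obtain w where w: "w \<in> Z" "w \<notin> {0}" unfolding Z_def by blast
  obtain z a where z: "z \<in> Z" "z \<noteq> 0" "gen_eigen a z" "shift a z = 0"
  proof -
    have "Z \<subseteq> span A" "\<delta> ` span A \<subseteq> span A" using \<delta>_closed V_span unfolding Z_def by auto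
    then show thesis
      using gen_eigen_outside[OF sZ dZ subspace_single_0 w finite_A] that by auto
  qed
  moreover have "a \<noteq> 0" using z gen_eigen_nonzero unfolding Z_def by blast
  ultimately show ?thesis unfolding Z_def shift_def by auto
qed

end

section \<open>Calculus in odd-quadratic odd-symplectic Lie superalgebras\<close>

lemma zsign_simps [simp]: "zsign 0 = 1" "zsign 1 = - 1"
  by (simp_all add: zsign_def)

context lie_superalgebra
begin

lemma carrier_subspace: "subspace (carrier L)"
  unfolding carrier_def by (intro subspace_sums subspace_grade)

lemmas carrier_closed = subspace_0[OF carrier_subspace] subspace_add[OF carrier_subspace]
  subspace_scale[OF carrier_subspace] subspace_diff[OF carrier_subspace]
  subspace_neg[OF carrier_subspace]

lemmas grade_closed = subspace_0[OF subspace_grade] subspace_add[OF subspace_grade]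
  subspace_scale[OF subspace_grade] subspace_diff[OF subspace_grade]
  subspace_neg[OF subspace_grade]

lemma grade_carrier: "x \<in> grade L \<alpha> \<Longrightarrow> x \<in> carrier L"
  unfolding carrier_def using grade_closed(1)
  by (cases \<alpha>) (force intro: exI[of _ x] exI[of _ 0])+

lemma carrierE:
  assumes "x \<in> carrier L"
  obtains x0 x1 where "x0 \<in> grade L 0" "x1 \<in> grade L 1" "x = x0 + x1"
  using assms unfolding carrier_def by blast

lemma carrier_induct [consumes 1, case_names homogeneous add]:
  assumes "x \<in> carrier L" and "\<And>\<alpha> x. x \<in> grade L \<alpha> \<Longrightarrow> P x"
    and "\<And>x y. x \<in> carrier L \<Longrightarrow> y \<in> carrier L \<Longrightarrow> P x \<Longrightarrow> P y \<Longrightarrow> P (x + y)"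
  shows "P x"
proof -
  obtain x0 x1 where x: "x0 \<in> grade L 0" "x1 \<in> grade L 1" "x = x0 + x1"
    using assms(1) by (rule carrierE)
  show ?thesis
    unfolding x(3) by (intro assms(3)) (use x assms(2) grade_carrier in blast)+
qed

lemma bracket_add_left:
  "\<lbrakk>x \<in> carrier L; y \<in> carrier L; z \<in> carrier L\<rbrakk> \<Longrightarrow> bracket L (x + y) z = bracket L x z + bracket L y z"
  and bracket_add_right:
  "\<lbrakk>x \<in> carrier L; y \<in> carrier L; z \<in> carrier L\<rbrakk> \<Longrightarrow> bracket L x (y + z) = bracket L x y + bracket L x z"
  and bracket_scale_left:
  "\<lbrakk>x \<in> carrier L; y \<in> carrier L\<rbrakk> \<Longrightarrow> bracket L (scale c x) y = scale c (bracket L x y)"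
  and bracket_scale_right:
  "\<lbrakk>x \<in> carrier L; y \<in> carrier L\<rbrakk> \<Longrightarrow> bracket L x (scale c y) = scale c (bracket L x y)"
  using bracket_bilinear unfolding bilinear_on_def linear_on_def by simp_all

lemma bracket_zero_right [simp]: "x \<in> carrier L \<Longrightarrow> bracket L x 0 = 0"
  using bracket_scale_right[of x 0 0] carrier_closed(1) by simp

lemma bracket_zero_left [simp]: "x \<in> carrier L \<Longrightarrow> bracket L 0 x = 0"
  using bracket_scale_left[of 0 x 0] carrier_closed(1) by simp

lemma bracket_neg_left: "\<lbrakk>x \<in> carrier L; y \<in> carrier L\<rbrakk> \<Longrightarrow> bracket L (- x) y = - bracket L x y"
  using bracket_scale_left[of x y "-1"] by simp

lemma bracket_neg_right: "\<lbrakk>x \<in> carrier L; y \<in> carrier L\<rbrakk> \<Longrightarrow> bracket L x (- y) = - bracket L x y"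
  using bracket_scale_right[of x y "-1"] by simp

lemma bracket_diff_right:
  "\<lbrakk>x \<in> carrier L; y \<in> carrier L; z \<in> carrier L\<rbrakk> \<Longrightarrow> bracket L x (y - z) = bracket L x y - bracket L x z"
  using bracket_add_right[of x y "- z"] bracket_neg_right[of x z] by (simp add: carrier_closed)

lemma bracket_diff_left:
  "\<lbrakk>x \<in> carrier L; y \<in> carrier L; z \<in> carrier L\<rbrakk> \<Longrightarrow> bracket L (x - y) z = bracket L x z - bracket L y z"
  using bracket_add_left[of x "- y" z] bracket_neg_left[of y z] by (simp add: carrier_closed)

lemma bracket_closed: "\<lbrakk>x \<in> carrier L; y \<in> carrier L\<rbrakk> \<Longrightarrow> bracket L x y \<in> carrier L"
proof (induction x rule: carrier_induct)
  case x: (homogeneous \<alpha> x)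
  show ?case using x(2)
  proof (induction y rule: carrier_induct)
    case (homogeneous \<beta> y)
    then show ?case using x(1) bracket_grade grade_carrier by blast
  qed (use x grade_carrier in \<open>auto simp: bracket_add_right carrier_closed\<close>)
qed (simp add: bracket_add_left carrier_closed)

lemma bracket_even_skew:
  assumes x: "x \<in> grade L 0" and y: "y \<in> carrier L" shows "bracket L x y = - bracket L y x"
  using y
proof (induction y rule: carrier_induct)
  case (homogeneous \<beta> y)
  then show ?case using bracket_skew[OF x, of y \<beta>] by simp
next
  case (add y z)
  then show ?case using x grade_carrier by (simp add: bracket_add_left bracket_add_right)
qed

lemma bracket_odd_sym: "\<lbrakk>x \<in> grade L 1; y \<in> grade L 1\<rbrakk> \<Longrightarrow> bracket L x y = bracket L y x"
  using bracket_skew[of x 1 y 1] by simp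

text \<open>
  The form of the Jacobi identity in which \<open>ad x\<close> is a superderivation; from here on it replaces the
  cyclic one.
\<close>

lemma leibniz:
  assumes x: "x \<in> grade L \<alpha>" and y: "y \<in> grade L \<beta>" and z: "z \<in> carrier L"
  shows "bracket L x (bracket L y z) =
    bracket L (bracket L x y) z + scale (zsign (\<alpha> * \<beta>)) (bracket L y (bracket L x z))"
  using z
proof (induction z rule: carrier_induct)
  case z: (homogeneous \<gamma> z)
  have c: "x \<in> carrier L" "y \<in> carrier L" "z \<in> carrier L" using x y z grade_carrier by auto
  have zx: "bracket L z x = - scale (zsign (\<gamma> * \<alpha>)) (bracket L x z)"
    by (rule bracket_skew[OF z x])
  have zxy: "bracket L z (bracket L x y) = - scale (zsign (\<gamma> * (\<alpha> + \<beta>))) (bracket L (bracket L x y) z)"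
    by (rule bracket_skew[OF z bracket_grade[OF x y]])
  show ?case
    using super_jacobi[OF x y z] c unfolding zx zxy
    by (cases \<alpha>; cases \<beta>; cases \<gamma>)
      (simp_all add: bracket_neg_right bracket_closed add_eq_0_iff eq_neg_iff_add_eq_0 algebra_simps)
next
  case (add z w)
  then show ?case using x y grade_carrier
    by (simp add: bracket_add_right bracket_closed scale_right_distrib algebra_simps)
qed

end

context odd_quadratic_odd_symplectic
begin

lemma
  form_bilinear: "bilinear_on (carrier L) scale (*) (form L)" and
  form_odd: "\<lbrakk>x \<in> grade L \<alpha>; y \<in> grade L \<alpha>\<rbrakk> \<Longrightarrow> form L x y = 0" and
  form_supersym: "\<lbrakk>x \<in> grade L \<alpha>; y \<in> grade L \<beta>\<rbrakk> \<Longrightarrow> form L x y = zsign (\<alpha> * \<beta>) * form L y x" and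
  form_invariant: "\<lbrakk>x \<in> carrier L; y \<in> carrier L; z \<in> carrier L\<rbrakk>
        \<Longrightarrow> form L (bracket L x y) z = form L x (bracket L y z)" and
  form_nondegenerate: "\<lbrakk>x \<in> carrier L; \<forall>y\<in>carrier L. form L x y = 0\<rbrakk> \<Longrightarrow> x = 0"
  using form unfolding odd_invariant_scalar_product_def odd_form_def nondegenerate_def by blast+

lemma
  sympl_bilinear: "bilinear_on (carrier L) scale (*) (sympl L)" and
  sympl_odd: "\<lbrakk>x \<in> grade L \<alpha>; y \<in> grade L \<alpha>\<rbrakk> \<Longrightarrow> sympl L x y = 0" and
  sympl_superskew: "\<lbrakk>x \<in> grade L \<alpha>; y \<in> grade L \<beta>\<rbrakk> \<Longrightarrow> sympl L x y = - zsign (\<alpha> * \<beta>) * sympl L y x" and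
  sympl_cocycle: "\<lbrakk>x \<in> grade L \<alpha>; y \<in> grade L \<beta>; z \<in> grade L \<gamma>\<rbrakk> \<Longrightarrow>
        zsign (\<gamma> * \<alpha>) * sympl L x (bracket L y z)
        + zsign (\<alpha> * \<beta>) * sympl L y (bracket L z x)
        + zsign (\<beta> * \<gamma>) * sympl L z (bracket L x y) = 0" and
  sympl_nondegenerate: "\<lbrakk>x \<in> carrier L; \<forall>y\<in>carrier L. sympl L x y = 0\<rbrakk> \<Longrightarrow> x = 0"
  using sympl unfolding odd_symplectic_form_def odd_form_def nondegenerate_def by blast+

lemma form_add_left: "\<lbrakk>x \<in> carrier L; y \<in> carrier L; z \<in> carrier L\<rbrakk> \<Longrightarrow> form L (x + y) z = form L x z + form L y z"
  and form_add_right: "\<lbrakk>x \<in> carrier L; y \<in> carrier L; z \<in> carrier L\<rbrakk> \<Longrightarrow> form L x (y + z) = form L x y + form L x z"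
  and form_scale_left: "\<lbrakk>x \<in> carrier L; y \<in> carrier L\<rbrakk> \<Longrightarrow> form L (scale c x) y = c * form L x y"
  and form_scale_right: "\<lbrakk>x \<in> carrier L; y \<in> carrier L\<rbrakk> \<Longrightarrow> form L x (scale c y) = c * form L x y"
  using form_bilinear unfolding bilinear_on_def linear_on_def by simp_all

lemma form_zero_left [simp]: "x \<in> carrier L \<Longrightarrow> form L 0 x = 0"
  using form_scale_left[of 0 x 0] carrier_closed(1) by simp

lemma form_zero_right [simp]: "x \<in> carrier L \<Longrightarrow> form L x 0 = 0"
  using form_scale_right[of x 0 0] carrier_closed(1) by simp

lemma form_neg_left: "\<lbrakk>x \<in> carrier L; y \<in> carrier L\<rbrakk> \<Longrightarrow> form L (- x) y = - form L x y"
  using form_scale_left[of x y "-1"] by simp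

lemma form_neg_right: "\<lbrakk>x \<in> carrier L; y \<in> carrier L\<rbrakk> \<Longrightarrow> form L x (- y) = - form L x y"
  using form_scale_right[of x y "-1"] by simp

lemma form_diff_left: "\<lbrakk>x \<in> carrier L; y \<in> carrier L; z \<in> carrier L\<rbrakk> \<Longrightarrow> form L (x - y) z = form L x z - form L y z"
  using form_add_left[of x "- y" z] form_neg_left[of y z] by (simp add: carrier_closed)

lemma form_diff_right: "\<lbrakk>x \<in> carrier L; y \<in> carrier L; z \<in> carrier L\<rbrakk> \<Longrightarrow> form L x (y - z) = form L x y - form L x z"
  using form_add_right[of x y "- z"] form_neg_right[of x z] by (simp add: carrier_closed)

lemma sympl_add_left: "\<lbrakk>x \<in> carrier L; y \<in> carrier L; z \<in> carrier L\<rbrakk> \<Longrightarrow> sympl L (x + y) z = sympl L x z + sympl L y z"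
  and sympl_add_right: "\<lbrakk>x \<in> carrier L; y \<in> carrier L; z \<in> carrier L\<rbrakk> \<Longrightarrow> sympl L x (y + z) = sympl L x y + sympl L x z"
  and sympl_scale_left: "\<lbrakk>x \<in> carrier L; y \<in> carrier L\<rbrakk> \<Longrightarrow> sympl L (scale c x) y = c * sympl L x y"
  using sympl_bilinear unfolding bilinear_on_def linear_on_def by simp_all

text \<open>
  Supersymmetry of an odd form is plain symmetry, since the sign differs from one only for two odd
  arguments, where the form vanishes.  In the same way an odd-symplectic form is plainly skew-symmetric.
\<close>

lemma form_sym:
  assumes "x \<in> carrier L" "y \<in> carrier L" shows "form L x y = form L y x"
proof -
  obtain a b c d where x: "a \<in> grade L 0" "b \<in> grade L 1" "x = a + b"
    and y: "c \<in> grade L 0" "d \<in> grade L 1" "y = c + d" using assms by (meson carrierE)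
  then show ?thesis
    using form_supersym[of a 0 d 1] form_supersym[of b 1 c 0]
      form_odd[of a 0 c] form_odd[of b 1 d] form_odd[of c 0 a] form_odd[of d 1 b]
    by (simp add: form_add_left form_add_right carrier_closed grade_carrier)
qed

lemma sympl_skew:
  assumes "x \<in> carrier L" "y \<in> carrier L" shows "sympl L x y = - sympl L y x"
proof -
  obtain a b c d where x: "a \<in> grade L 0" "b \<in> grade L 1" "x = a + b"
    and y: "c \<in> grade L 0" "d \<in> grade L 1" "y = c + d" using assms by (meson carrierE)
  then show ?thesis
    using sympl_superskew[of a 0 d 1] sympl_superskew[of b 1 c 0]
      sympl_odd[of a 0 c] sympl_odd[of b 1 d] sympl_odd[of c 0 a] sympl_odd[of d 1 b]
    by (simp add: sympl_add_left sympl_add_right carrier_closed grade_carrier)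
qed

lemma form_eqI:
  assumes x: "x \<in> carrier L" and y: "y \<in> carrier L"
    and eq: "\<And>\<alpha> z. z \<in> grade L \<alpha> \<Longrightarrow> form L x z = form L y z"
  shows "x = y"
proof -
  have "form L (x - y) z = 0" if "z \<in> carrier L" for z
    using that
  proof (induction z rule: carrier_induct)
    case (homogeneous \<alpha> z)
    then show ?case using eq x y by (simp add: form_diff_left grade_carrier)
  next
    case (add z w)
    then show ?case using x y by (simp add: form_add_right carrier_closed)
  qed
  then have "x - y = 0" using x y by (intro form_nondegenerate carrier_closed) auto
  then show ?thesis by simp
qed

text \<open>
  An odd nondegenerate form pairs \<open>\<gg>\<^sub>0\<close> with \<open>\<gg>\<^sub>1\<close>, so each component is its own orthogonal.
\<close>

lemma gradeI:
  assumes x: "x \<in> carrier L" and orth: "\<And>z. z \<in> grade L \<alpha> \<Longrightarrow> form L x z = 0"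
  shows "x \<in> grade L \<alpha>"
proof -
  obtain a b where ab: "a \<in> grade L \<alpha>" "b \<in> grade L (\<alpha> + 1)" "x = a + b"
    using x by (cases \<alpha>) (auto elim!: carrierE simp: add.commute)
  have "b = 0"
  proof (rule form_eqI)
    fix \<beta> z assume z: "z \<in> grade L \<beta>"
    then have zc: "z \<in> carrier L" by (rule grade_carrier)
    have "\<beta> = \<alpha> \<or> \<beta> = \<alpha> + 1" by (cases \<alpha>; cases \<beta>) auto
    then have "form L b z = 0"
    proof
      assume "\<beta> = \<alpha>"
      then show ?thesis using orth[of z] form_odd[OF ab(1)] z ab zc
        by (simp add: form_add_left grade_carrier)
    qed (use form_odd[OF ab(2)] z in simp)
    then show "form L b z = form L 0 z" using zc by simp
  qed (use ab grade_carrier carrier_closed in auto)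
  then show ?thesis using ab by simp
qed

text \<open>
  Represent the functionals \<open>\<omega>(x,-)\<close> through \<open>B\<close>.  The values are prescribed on a basis only, which
  allows an extension of \<open>\<delta>\<close> that is linear on the whole ambient space.
\<close>

lemma associated_map_exists:
  "\<exists>\<delta>. Vector_Spaces.linear scale scale \<delta> \<and> \<delta> ` carrier L \<subseteq> carrier L \<and>
     (\<forall>x\<in>carrier L. \<forall>y\<in>carrier L. sympl L x y = form L (\<delta> x) y)"
proof -
  obtain A where A: "finite A" "carrier L = span A" using finite_dim by blast
  obtain C where C: "C \<subseteq> carrier L" "independent C" "carrier L \<subseteq> span C"
    using maximal_independent_subset by blast
  have "\<exists>z\<in>carrier L. \<forall>y\<in>carrier L. form L z y = sympl L x y" if "x \<in> carrier L" for x
    using sympl_bilinear that form_nondegenerate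
    by (intro nondegenerate_form_represents[OF carrier_subspace A form_bilinear])
       (auto simp: bilinear_on_def)
  then obtain f where f: "\<And>x y. x \<in> carrier L \<Longrightarrow> y \<in> carrier L \<Longrightarrow> form L (f x) y = sympl L x y"
      "\<And>x. x \<in> carrier L \<Longrightarrow> f x \<in> carrier L" by metis
  interpret vp: vector_space_pair scale scale ..
  obtain \<delta> where \<delta>: "Vector_Spaces.linear scale scale \<delta>" "\<And>x. x \<in> C \<Longrightarrow> \<delta> x = f x"
    using vp.linear_independent_extend[OF C(2), of f] by blast
  interpret \<delta>: Vector_Spaces.linear scale scale \<delta> by (rule \<delta>(1))
  have "x \<in> carrier L \<and> \<delta> x \<in> carrier L \<and> (\<forall>y\<in>carrier L. sympl L x y = form L (\<delta> x) y)"
    if x: "x \<in> carrier L" for x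
  proof (rule span_induct_alt[of x C])
    show "x \<in> span C" using x C by blast
    show "0 \<in> carrier L \<and> \<delta> 0 \<in> carrier L \<and> (\<forall>y\<in>carrier L. sympl L 0 y = form L (\<delta> 0) y)"
      using sympl_scale_left[of 0 _ 0] carrier_closed(1) by simp
    fix c x y assume xy: "x \<in> C" "y \<in> carrier L \<and> \<delta> y \<in> carrier L \<and> (\<forall>z\<in>carrier L. sympl L y z = form L (\<delta> y) z)"
    have xc: "x \<in> carrier L" using xy C by blast
    then have "\<delta> x \<in> carrier L" "\<forall>z\<in>carrier L. sympl L x z = form L (\<delta> x) z"
      using xy \<delta>(2) f by auto
    then show "scale c x + y \<in> carrier L \<and> \<delta> (scale c x + y) \<in> carrier L \<and>
       (\<forall>z\<in>carrier L. sympl L (scale c x + y) z = form L (\<delta> (scale c x + y)) z)"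
      using xc xy(2) by (auto simp: \<delta>.add \<delta>.scale carrier_closed sympl_add_left sympl_scale_left
          form_add_left form_scale_left)
  qed
  then show ?thesis using \<delta>(1) by blast
qed

end

locale odd_quadratic_with_derivation = odd_quadratic_odd_symplectic scale L + endomorphism scale \<delta>
  for scale :: "'k::{alg_closed_field, field_char_0} \<Rightarrow> 'v::ab_group_add \<Rightarrow> 'v"
    and L :: "('k, 'v, 'x) bi_form_superalgebra_scheme" and \<delta> +
  assumes \<delta>_carrier: "x \<in> carrier L \<Longrightarrow> \<delta> x \<in> carrier L"
    and sympl_eq: "\<lbrakk>x \<in> carrier L; y \<in> carrier L\<rbrakk> \<Longrightarrow> sympl L x y = form L (\<delta> x) y"
begin

lemma \<delta>_skew: "\<lbrakk>x \<in> carrier L; y \<in> carrier L\<rbrakk> \<Longrightarrow> form L (\<delta> x) y = - form L x (\<delta> y)"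
  using sympl_skew[of x y] form_sym[of x "\<delta> y"] by (simp add: sympl_eq \<delta>_carrier)

lemma \<delta>_injective: "\<lbrakk>x \<in> carrier L; \<delta> x = 0\<rbrakk> \<Longrightarrow> x = 0"
  using sympl_nondegenerate[of x] by (simp add: sympl_eq)

lemma \<delta>_grade: "x \<in> grade L \<alpha> \<Longrightarrow> \<delta> x \<in> grade L \<alpha>"
  using sympl_odd[of x \<alpha>] by (intro gradeI) (auto simp: sympl_eq \<delta>_carrier grade_carrier)

text \<open>
  By invariance of \<open>B\<close> the cocycle condition, paired with \<open>z\<close>, is the derivation rule.  All three terms
  vanish when \<open>\<alpha> + \<beta> + \<gamma>\<close> is even; otherwise one or three of the arguments are odd and the three signs
  coincide.
\<close>

lemma \<delta>_derivation_homogeneous: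
  assumes x: "x \<in> grade L \<alpha>" and y: "y \<in> grade L \<beta>"
  shows "\<delta> (bracket L x y) = bracket L (\<delta> x) y + bracket L x (\<delta> y)"
proof (rule form_eqI)
  have c: "x \<in> carrier L" "y \<in> carrier L" "\<delta> x \<in> carrier L" "\<delta> y \<in> carrier L"
    using x y grade_carrier \<delta>_carrier by auto
  then show "\<delta> (bracket L x y) \<in> carrier L" "bracket L (\<delta> x) y + bracket L x (\<delta> y) \<in> carrier L"
    by (auto intro: \<delta>_carrier carrier_closed bracket_closed)
  fix \<gamma> z assume z: "z \<in> grade L \<gamma>"
  have zc: "z \<in> carrier L" by (rule grade_carrier[OF z])
  have 1: "sympl L x (bracket L y z) = form L (bracket L (\<delta> x) y) z"
    using c zc by (simp add: sympl_eq bracket_closed form_invariant)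
  have "sympl L y (bracket L z x) = form L (bracket L z x) (\<delta> y)"
    using c zc by (simp add: sympl_eq bracket_closed form_sym)
  also have "\<dots> = form L z (bracket L x (\<delta> y))" using c zc by (simp add: form_invariant)
  also have "\<dots> = form L (bracket L x (\<delta> y)) z" using c zc by (simp add: form_sym bracket_closed)
  finally have 2: "sympl L y (bracket L z x) = form L (bracket L x (\<delta> y)) z" .
  have 3: "sympl L z (bracket L x y) = - form L (\<delta> (bracket L x y)) z"
    using c zc sympl_skew[of z "bracket L x y"] by (simp add: sympl_eq bracket_closed)
  have eq: "zsign (\<gamma> * \<alpha>) * form L (bracket L (\<delta> x) y) z
      + zsign (\<alpha> * \<beta>) * form L (bracket L x (\<delta> y)) z
      - zsign (\<beta> * \<gamma>) * form L (\<delta> (bracket L x y)) z = 0"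
    using sympl_cocycle[OF x y z] unfolding 1 2 3 by simp
  have g: "bracket L (\<delta> x) y \<in> grade L (\<alpha> + \<beta>)" "bracket L x (\<delta> y) \<in> grade L (\<alpha> + \<beta>)"
      "\<delta> (bracket L x y) \<in> grade L (\<alpha> + \<beta>)"
    by (rule bracket_grade[OF \<delta>_grade[OF x] y] bracket_grade[OF x \<delta>_grade[OF y]]
        \<delta>_grade[OF bracket_grade[OF x y]])+
  show "form L (\<delta> (bracket L x y)) z = form L (bracket L (\<delta> x) y + bracket L x (\<delta> y)) z"
  proof (cases "\<gamma> = \<alpha> + \<beta>")
    case True
    then have "form L (\<delta> (bracket L x y)) z = 0" "form L (bracket L (\<delta> x) y) z = 0"
        "form L (bracket L x (\<delta> y)) z = 0"
      using g z form_odd by auto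
    then show ?thesis using c zc by (simp add: form_add_left bracket_closed)
  next
    case False
    have "form L (\<delta> (bracket L x y)) z = form L (bracket L (\<delta> x) y) z + form L (bracket L x (\<delta> y)) z"
      using eq False by (cases \<alpha>; cases \<beta>; cases \<gamma>) (auto simp: algebra_simps)
    then show ?thesis using c zc by (simp add: form_add_left bracket_closed)
  qed
qed

lemma \<delta>_derivation:
  assumes x: "x \<in> carrier L" and y: "y \<in> carrier L"
  shows "\<delta> (bracket L x y) = bracket L (\<delta> x) y + bracket L x (\<delta> y)"
  using x y
proof (induction x rule: carrier_induct)
  case x: (homogeneous \<alpha> x)
  show ?case using x(2)
  proof (induction y rule: carrier_induct)
    case (homogeneous \<beta> y)
    then show ?case using x(1) \<delta>_derivation_homogeneous by blast
  next
    case (add y z)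
    then show ?case using x(1) grade_carrier \<delta>_carrier
      by (simp add: bracket_add_right \<delta>.add algebra_simps)
  qed
next
  case (add x z)
  then show ?case using \<delta>_carrier
    by (simp add: bracket_add_left \<delta>.add algebra_simps)
qed

lemma even_part_lie_algebra:
  obtains A where "lie_algebra_derivation scale \<delta> (grade L 0) (bracket L) A"
proof -
  obtain A where A: "finite A" "carrier L = span A" using finite_dim by blast
  obtain C where C: "C \<subseteq> grade L 0" "independent C" "grade L 0 \<subseteq> span C"
    using maximal_independent_subset by blast
  have eq: "grade L 0 = span C"
    using C(3) span_minimal[OF C(1) subspace_grade] by blast
  have "finite C"
    using independent_span_bound[OF A(1) C(2)] C(1) grade_carrier A(2) by blast
  then have "lie_algebra_derivation_axioms scale \<delta> (grade L 0) (bracket L) C"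
  proof (intro lie_algebra_derivation_axioms.intro)
    fix x y z assume x: "x \<in> grade L 0" and y: "y \<in> grade L 0" and z: "z \<in> grade L 0"
    note c = x[THEN grade_carrier] y[THEN grade_carrier] z[THEN grade_carrier]
    show "bracket L x (bracket L y z) = bracket L (bracket L x y) z + bracket L y (bracket L x z)"
      using leibniz[OF x y c(3)] by simp
    show "bracket L x (y + z) = bracket L x y + bracket L x z"
      by (rule bracket_add_right[OF c])
  next
    fix x y c assume x: "x \<in> grade L 0" and y: "y \<in> grade L 0"
    note c = x[THEN grade_carrier] y[THEN grade_carrier]
    show "bracket L x y \<in> grade L 0" using bracket_grade[OF x y] by simp
    show "bracket L x (scale c y) = scale c (bracket L x y)" by (rule bracket_scale_right[OF c])
    show "bracket L x y = - bracket L y x" by (rule bracket_even_skew[OF x c(2)])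
    show "\<delta> (bracket L x y) = bracket L (\<delta> x) y + bracket L x (\<delta> y)" by (rule \<delta>_derivation[OF c])
  next
    show "\<delta> ` grade L 0 \<subseteq> grade L 0" using \<delta>_grade by blast
    show "x = 0" if "x \<in> grade L 0" "\<delta> x = 0" for x
      by (rule \<delta>_injective[OF grade_carrier[OF that(1)] that(2)])
    show "grade L 0 = span C" by (rule eq)
  qed assumption
  then have "lie_algebra_derivation scale \<delta> (grade L 0) (bracket L) C"
    by (intro lie_algebra_derivation.intro endomorphism_axioms)
  then show thesis by (rule that)
qed

text \<open>
  Since \<open>B([z,x],y) = - B(x,[z,y])\<close>, an element that is central in the even part also commutes with
  the odd part.  The even part is nonzero, as the odd form \<open>B\<close> would otherwise vanish.
\<close>

lemma central_even_eigenvector_exists: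
  assumes "carrier L \<noteq> {0}"
  shows "\<exists>z\<in>grade L 0. \<exists>a. z \<noteq> 0 \<and> a \<noteq> 0 \<and> \<delta> z = scale a z \<and> (\<forall>x\<in>carrier L. bracket L z x = 0)"
proof -
  obtain A where "lie_algebra_derivation scale \<delta> (grade L 0) (bracket L) A"
    by (rule even_part_lie_algebra)
  then interpret even: lie_algebra_derivation scale \<delta> "grade L 0" "bracket L" A .
  have "grade L 0 \<noteq> {0}"
  proof
    assume g0: "grade L 0 = {0}"
    have "x = 0" if "x \<in> carrier L" for x
    proof (rule form_eqI)
      have x1: "x \<in> grade L 1" using that g0 by (auto elim!: carrierE)
      fix \<alpha> z assume "z \<in> grade L \<alpha>"
      then have "z \<in> grade L 1" using g0 grade_closed(1) by (cases \<alpha>) auto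
      then show "form L x z = form L 0 z" using form_odd[OF x1] by (simp add: grade_carrier)
    qed (use that carrier_closed in auto)
    then show False using assms carrier_closed(1) by auto
  qed
  then obtain z a where z: "z \<in> grade L 0" "z \<noteq> 0" "a \<noteq> 0" "\<delta> z = scale a z"
      "\<And>x. x \<in> grade L 0 \<Longrightarrow> bracket L x z = 0"
    using even.central_eigenvector_exists by blast
  have zc: "z \<in> carrier L" by (rule grade_carrier[OF z(1)])
  have z0: "bracket L z x = 0" if "x \<in> grade L 0" for x
    using z(5)[OF that] bracket_even_skew[OF z(1), of x] that by (simp add: grade_carrier)
  have "bracket L z x = 0" if x: "x \<in> grade L 1" for x
  proof (rule form_eqI)
    have xc: "x \<in> carrier L" by (rule grade_carrier[OF x])
    then show "bracket L z x \<in> carrier L" "0 \<in> carrier L" using zc by (auto intro: bracket_closed carrier_closed)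
    fix \<alpha> y assume y: "y \<in> grade L \<alpha>"
    have yc: "y \<in> carrier L" by (rule grade_carrier[OF y])
    have "form L (bracket L z x) y = 0"
    proof (cases \<alpha> rule: bit.exhaust[case_names zero one])
      case zero
      have "form L (bracket L z x) y = - form L (bracket L x z) y"
        using bracket_even_skew[OF z(1) xc] xc yc zc by (simp add: form_neg_left bracket_closed)
      also have "\<dots> = - form L x (bracket L z y)" using xc yc zc by (simp add: form_invariant)
      finally show ?thesis using z0 y zero xc by simp
    next
      case one
      then show ?thesis using form_odd bracket_grade[OF z(1) x] y by simp
    qed
    then show "form L (bracket L z x) y = form L 0 y" using yc by simp
  qed
  with z0 have "bracket L z x = 0" if "x \<in> carrier L" for x
    using that by (auto elim!: carrierE simp: bracket_add_right zc grade_carrier)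
  with z show ?thesis by blast
qed

lemma dual_odd_vector_exists:
  assumes z: "z \<in> grade L 0" "z \<noteq> 0"
  shows "\<exists>e\<in>grade L 1. form L z e = 1"
proof -
  have zc: "z \<in> carrier L" by (rule grade_carrier[OF z(1)])
  then obtain y where y: "y \<in> carrier L" "form L z y \<noteq> 0" using form_nondegenerate z(2) by blast
  then obtain a b where ab: "a \<in> grade L 0" "b \<in> grade L 1" "y = a + b" by (auto elim: carrierE)
  then have b: "form L z b \<noteq> 0"
    using y(2) form_odd[OF z(1) ab(1)] zc by (simp add: form_add_right grade_carrier)
  show ?thesis
    by (rule bexI[of _ "scale (inverse (form L z b)) b"])
      (use b ab zc in \<open>auto simp: form_scale_right grade_carrier grade_closed\<close>)
qed

end

section \<open>Splitting off a central even eigenvector\<close>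

text \<open>
  Here \<open>es\<close> plays the part of \<open>e\<^sup>*\<close>, and \<open>l\<close> that of \<open>\<lambda>\<close>.
\<close>

locale central_even_eigenvector = odd_quadratic_with_derivation scale L \<delta>
  for scale :: "'k::{alg_closed_field, field_char_0} \<Rightarrow> 'v::ab_group_add \<Rightarrow> 'v"
    and L :: "('k, 'v, 'x) bi_form_superalgebra_scheme" and \<delta> +
  fixes es e :: 'v and l :: 'k
  assumes es_even: "es \<in> grade L 0" and e_odd: "e \<in> grade L 1" and form_es_e: "form L es e = 1"
    and es_central: "x \<in> carrier L \<Longrightarrow> bracket L es x = 0"
    and \<delta>_es: "\<delta> es = scale l es" and l_nonzero: "l \<noteq> 0"
begin

text \<open>
  The projection onto the orthogonal of \<open>{es, e}\<close> along their span; \<open>es\<close> and \<open>e\<close> are isotropic and dual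
  to each other, which is why each coefficient pairs with the other vector.
\<close>

definition P :: "'v \<Rightarrow> 'v" where
  "P x = x - scale (form L x e) es - scale (form L es x) e"

text \<open>
  A complement of \<open>es\<close> in its orthogonal, so that \<open>es\<^sup>\<bottom> / es\<close> can be realized inside the same ambient
  space.
\<close>

definition H :: "('k, 'v) bi_form_superalgebra" where
  "H = \<lparr>grade = (\<lambda>\<alpha>. {x \<in> grade L \<alpha>. form L x e = 0 \<and> form L es x = 0}),
        bracket = (\<lambda>x y. P (bracket L x y)), form = form L, sympl = sympl L\<rparr>"

definition D :: "'v \<Rightarrow> 'v" where "D x = P (bracket L e x)"
definition x\<^sub>0 :: 'v where "x\<^sub>0 = P (bracket L e e)"
definition k :: 'k where "k = form L (bracket L e e) e"
definition c\<^sub>1 :: 'v where "c\<^sub>1 = P (\<delta> e)"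
definition \<delta>\<^sub>H :: "'v \<Rightarrow> 'v" where "\<delta>\<^sub>H x = P (\<delta> x)"

lemma H_simps [simp]:
  "grade H \<alpha> = {x \<in> grade L \<alpha>. form L x e = 0 \<and> form L es x = 0}"
  "bracket H x y = P (bracket L x y)" "form H = form L" "sympl H = sympl L"
  by (simp_all add: H_def)

lemma es_carrier [simp]: "es \<in> carrier L" and e_carrier [simp]: "e \<in> carrier L"
  using es_even e_odd grade_carrier by auto

lemma form_values [simp]: "form L es e = 1" "form L e es = 1" "form L es es = 0" "form L e e = 0"
  using form_es_e form_sym[of e es] form_odd es_even e_odd by auto

lemma es_central_right: "x \<in> carrier L \<Longrightarrow> bracket L x es = 0"
  using bracket_even_skew[OF es_even, of x] es_central[of x] by simp

lemmas closed [simp, intro] = carrier_closed bracket_closed \<delta>_carrier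

lemmas form_lin = form_add_left form_add_right form_scale_left form_scale_right form_diff_left
  form_diff_right form_neg_left form_neg_right

lemmas br_lin = bracket_add_left bracket_add_right bracket_scale_left bracket_scale_right
  bracket_diff_left bracket_diff_right bracket_neg_left bracket_neg_right

lemma P_carrier [simp]: "x \<in> carrier L \<Longrightarrow> P x \<in> carrier L"
  by (simp add: P_def)

lemma form_P_e [simp]: "x \<in> carrier L \<Longrightarrow> form L (P x) e = 0"
  by (simp add: P_def form_lin)

lemma form_es_P [simp]: "x \<in> carrier L \<Longrightarrow> form L es (P x) = 0"
  by (simp add: P_def form_lin)

lemma P_add: "\<lbrakk>x \<in> carrier L; y \<in> carrier L\<rbrakk> \<Longrightarrow> P (x + y) = P x + P y"
  by (simp add: P_def form_lin scale_left_distrib algebra_simps)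

lemma P_scale: "x \<in> carrier L \<Longrightarrow> P (scale c x) = scale c (P x)"
  by (simp add: P_def form_lin scale_right_diff_distrib)

lemma P_neg: "x \<in> carrier L \<Longrightarrow> P (- x) = - P x"
  using P_scale[of x "-1"] by simp

lemma P_diff: "\<lbrakk>x \<in> carrier L; y \<in> carrier L\<rbrakk> \<Longrightarrow> P (x - y) = P x - P y"
  using P_add[of x "- y"] P_neg[of y] by simp

lemma P_0 [simp]: "P 0 = 0"
  by (simp add: P_def)

lemma P_es [simp]: "P es = 0"
  by (simp add: P_def)

lemma P_e [simp]: "P e = 0"
  by (simp add: P_def)

lemmas P_lin = P_add P_scale P_neg P_diff

lemma P_id: "form L x e = 0 \<Longrightarrow> form L es x = 0 \<Longrightarrow> P x = x"
  by (simp add: P_def)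

lemma decomposition: "x = scale (form L x e) es + P x + scale (form L es x) e"
  by (simp add: P_def)

lemma P_grade: "x \<in> grade L \<alpha> \<Longrightarrow> P x \<in> grade L \<alpha>"
  using form_odd[OF es_even, of x] form_odd[of x 1 e] es_even e_odd
  by (cases \<alpha>) (auto simp: P_def intro!: grade_closed)

lemma carrier_H: "carrier H = {x \<in> carrier L. form L x e = 0 \<and> form L es x = 0}"
proof
  show "carrier H \<subseteq> {x \<in> carrier L. form L x e = 0 \<and> form L es x = 0}"
    unfolding carrier_def[of H] by (auto simp: grade_carrier form_lin)
  show "{x \<in> carrier L. form L x e = 0 \<and> form L es x = 0} \<subseteq> carrier H"
  proof safe
    fix x assume x: "x \<in> carrier L" "form L x e = 0" "form L es x = 0"
    then obtain a b where ab: "a \<in> grade L 0" "b \<in> grade L 1" "x = a + b" by (auto elim: carrierE)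
    have "form L b e = 0" "form L es a = 0"
      using form_odd[OF ab(2) e_odd] form_odd[OF es_even ab(1)] by auto
    then have "a \<in> grade H 0" "b \<in> grade H 1"
      using x(2,3) ab grade_carrier by (auto simp: form_lin)
    then show "x \<in> carrier H" unfolding carrier_def[of H] using ab(3) by blast
  qed
qed

lemma in_H:
  assumes "x \<in> carrier H"
  shows "x \<in> carrier L" "form L x e = 0" "form L e x = 0" "form L es x = 0" "form L x es = 0" "P x = x"
  using assms form_sym[of x e] form_sym[of x es] unfolding carrier_H by (auto intro: P_id)

lemma P_in_H [simp]: "x \<in> carrier L \<Longrightarrow> P x \<in> carrier H"
  unfolding carrier_H by simp

lemma P_grade_H: "x \<in> grade L \<alpha> \<Longrightarrow> P x \<in> grade H \<alpha>"
  using P_grade grade_carrier by simp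

lemma H_grade_carrier: "x \<in> grade H \<alpha> \<Longrightarrow> x \<in> carrier H"
  using grade_carrier by (auto simp: carrier_H)

lemma form_P_right: "\<lbrakk>x \<in> carrier H; y \<in> carrier L\<rbrakk> \<Longrightarrow> form L x (P y) = form L x y"
  using in_H[of x] by (simp add: P_def form_lin)

lemma form_P_left: "\<lbrakk>x \<in> carrier L; y \<in> carrier H\<rbrakk> \<Longrightarrow> form L (P x) y = form L x y"
  using in_H[of y] by (simp add: P_def form_lin)

text \<open>
  All brackets lie in the orthogonal of the central element \<open>es\<close>.  This and centrality let the next
  lemmas drop inner projections, since for \<open>y\<close> orthogonal to \<open>es\<close> the difference \<open>y - P y\<close> is a multiple of \<open>es\<close>.
\<close>

lemma form_es_bracket [simp]:
  assumes "x \<in> carrier L" "y \<in> carrier L" shows "form L es (bracket L x y) = 0"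
  using form_invariant[of es x y] assms es_central by simp

lemma form_es_\<delta>: "x \<in> carrier L \<Longrightarrow> form L es (\<delta> x) = - l * form L es x"
  using \<delta>_skew[of es x] by (simp add: \<delta>_es form_lin)

lemma bracket_P_right:
  "\<lbrakk>x \<in> carrier L; y \<in> carrier L; form L es y = 0\<rbrakk> \<Longrightarrow> bracket L x (P y) = bracket L x y"
  by (simp add: P_def br_lin es_central_right)

lemma bracket_P_left:
  "\<lbrakk>x \<in> carrier L; y \<in> carrier L; form L es x = 0\<rbrakk> \<Longrightarrow> bracket L (P x) y = bracket L x y"
  by (simp add: P_def br_lin es_central)

lemma sympl_P_right:
  assumes "x \<in> carrier H" "y \<in> carrier L" "form L es y = 0"
  shows "sympl L x (P y) = sympl L x y"
proof -
  have "form L (\<delta> x) es = 0"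
    using in_H[OF assms(1)] form_es_\<delta>[of x] form_sym[of es "\<delta> x"] by simp
  then show ?thesis using assms in_H[OF assms(1)] by (simp add: sympl_eq P_def form_lin)
qed

text \<open>
  \<open>\<delta>\<close> preserves the line of \<open>es\<close>, so it induces a map on the quotient \<open>es\<^sup>\<bottom> / es\<close>.
\<close>

lemma P_\<delta>_P:
  assumes "x \<in> carrier L" "form L es x = 0" shows "P (\<delta> (P x)) = P (\<delta> x)"
  using assms by (simp add: P_def[of x] \<delta>.diff \<delta>.scale \<delta>_es P_lin)

lemma H_lie_superalgebra: "lie_superalgebra scale H"
proof
  show "subspace (grade H \<alpha>)" for \<alpha>
    using grade_closed grade_carrier by (auto simp: subspace_def form_lin)
  show "grade H 0 \<inter> grade H 1 = {0}"
    using grade_Int grade_closed(1) by auto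
  show "\<exists>A. finite A \<and> carrier H = span A"
  proof -
    obtain A where A: "finite A" "carrier L = span A" using finite_dim by blast
    obtain C where C: "C \<subseteq> carrier H" "independent C" "carrier H \<subseteq> span C"
      using maximal_independent_subset by blast
    have "subspace (carrier H)" by (auto simp: carrier_H subspace_def form_lin)
    then have "carrier H = span C" using C(1,3) span_minimal by blast
    moreover have "C \<subseteq> span A" using C(1) A(2) unfolding carrier_H by blast
    then have "finite C" using independent_span_bound[OF A(1) C(2)] by blast
    ultimately show ?thesis by blast
  qed
  show "bilinear_on (carrier H) scale scale (bracket H)"
    unfolding bilinear_on_def linear_on_def using in_H(1) by (auto simp: br_lin P_lin)
next
  fix x y \<alpha> \<beta> assume xy: "x \<in> grade H \<alpha>" "y \<in> grade H \<beta>"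
  then have g: "x \<in> grade L \<alpha>" "y \<in> grade L \<beta>" by auto
  note c = g[THEN grade_carrier]
  show "bracket H x y \<in> grade H (\<alpha> + \<beta>)"
    using P_grade_H[OF bracket_grade[OF g]] by simp
  show "bracket H x y = - scale (zsign (\<alpha> * \<beta>)) (bracket H y x)"
    using c unfolding H_simps bracket_skew[OF g] by (simp add: P_lin)
next
  fix x y z \<alpha> \<beta> \<gamma> assume xy: "x \<in> grade H \<alpha>" "y \<in> grade H \<beta>" "z \<in> grade H \<gamma>"
  then have g: "x \<in> grade L \<alpha>" "y \<in> grade L \<beta>" "z \<in> grade L \<gamma>" by auto
  note c = g[THEN grade_carrier]
  show "scale (zsign (\<gamma> * \<alpha>)) (bracket H x (bracket H y z))
          + scale (zsign (\<alpha> * \<beta>)) (bracket H y (bracket H z x))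
          + scale (zsign (\<beta> * \<gamma>)) (bracket H z (bracket H x y)) = 0"
    using c arg_cong[OF super_jacobi[OF g], of P]
    by (simp add: P_lin bracket_P_right)
qed

lemma H_form: "odd_invariant_scalar_product scale H (form H)"
  unfolding odd_invariant_scalar_product_def
proof (intro conjI)
  show "bilinear_on (carrier H) scale (*) (form H)"
    unfolding bilinear_on_def linear_on_def using in_H(1) by (auto simp: form_lin)
  show "odd_form H (form H)" unfolding odd_form_def using form_odd by auto
  show "\<forall>\<alpha> \<beta>. \<forall>x\<in>grade H \<alpha>. \<forall>y\<in>grade H \<beta>. form H x y = zsign (\<alpha> * \<beta>) * form H y x"
    using form_supersym by simp
  show "\<forall>x\<in>carrier H. \<forall>y\<in>carrier H. \<forall>z\<in>carrier H.
        form H (bracket H x y) z = form H x (bracket H y z)"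
    using in_H(1) form_invariant by (simp add: form_P_left form_P_right)
  have nd: "x = 0" if x: "x \<in> carrier H" and orth: "\<And>y. y \<in> carrier H \<Longrightarrow> form L x y = 0" for x
  proof -
    have "form L x y = 0" if "y \<in> carrier L" for y
      using orth[of "P y"] form_P_right[OF x that] that by simp
    then show ?thesis using form_nondegenerate in_H(1)[OF x] by blast
  qed
  moreover have "form L x y = form L y x" if "x \<in> carrier H" "y \<in> carrier H" for x y
    using that in_H(1) form_sym by blast
  ultimately show "nondegenerate H (form H)" unfolding nondegenerate_def by simp
qed

text \<open>
  If \<open>\<delta>\<^sub>H x = 0\<close>, then \<open>\<delta> x\<close> is a multiple of \<open>es\<close>, hence so is \<open>x\<close>, because \<open>\<delta>\<close> is injective and
  \<open>es\<close> is an eigenvector with nonzero eigenvalue.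
\<close>

lemma \<delta>\<^sub>H_injective:
  assumes x: "x \<in> carrier H" and eq: "\<delta>\<^sub>H x = 0" shows "x = 0"
proof -
  note xH = in_H[OF x]
  define a where "a = form L (\<delta> x) e / l"
  have "\<delta> x = scale (form L (\<delta> x) e) es"
    using decomposition[of "\<delta> x"] eq xH by (simp add: \<delta>\<^sub>H_def form_es_\<delta>)
  also have "\<dots> = \<delta> (scale a es)" using l_nonzero by (simp add: a_def \<delta>.scale \<delta>_es)
  finally have "\<delta> (x - scale a es) = 0" by (simp add: \<delta>.diff)
  moreover have "x - scale a es \<in> carrier L" using xH(1) by simp
  ultimately have "x - scale a es = 0" by (rule \<delta>_injective[rotated])
  then have x_eq: "x = scale a es" by simp
  then have "form L x e = a" by (simp add: form_lin)
  then show ?thesis using xH(2) x_eq by simp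
qed

lemma H_sympl_eq:
  "\<lbrakk>x \<in> carrier H; y \<in> carrier H\<rbrakk> \<Longrightarrow> sympl L x y = form L (\<delta>\<^sub>H x) y"
  using in_H(1) by (simp add: sympl_eq \<delta>\<^sub>H_def form_P_left)

lemma \<delta>\<^sub>H_carrier: "x \<in> carrier H \<Longrightarrow> \<delta>\<^sub>H x \<in> carrier H"
  using in_H(1) by (simp add: \<delta>\<^sub>H_def)

lemma H_sympl: "odd_symplectic_form scale H (sympl H)"
  unfolding odd_symplectic_form_def
proof (intro conjI)
  show "bilinear_on (carrier H) scale (*) (sympl H)"
    using in_H(1) sympl_bilinear unfolding bilinear_on_def linear_on_def by simp
  show "odd_form H (sympl H)" unfolding odd_form_def using sympl_odd by auto
  show "\<forall>\<alpha> \<beta>. \<forall>x\<in>grade H \<alpha>. \<forall>y\<in>grade H \<beta>. sympl H x y = - zsign (\<alpha> * \<beta>) * sympl H y x"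
    using sympl_superskew by simp
  have nd: "x = 0" if x: "x \<in> carrier H" and orth: "\<And>y. y \<in> carrier H \<Longrightarrow> sympl L x y = 0" for x
  proof -
    have "nondegenerate H (form H)" using H_form unfolding odd_invariant_scalar_product_def by blast
    then have "\<delta>\<^sub>H x = 0"
      using \<delta>\<^sub>H_carrier[OF x] H_sympl_eq[OF x] orth unfolding nondegenerate_def by simp
    then show ?thesis using \<delta>\<^sub>H_injective[OF x] by blast
  qed
  moreover have "sympl L x y = 0 \<longleftrightarrow> sympl L y x = 0" if "x \<in> carrier H" "y \<in> carrier H" for x y
    using sympl_skew[of x y] that in_H(1) by simp
  ultimately show "nondegenerate H (sympl H)" unfolding nondegenerate_def by simp
  show "\<forall>\<alpha> \<beta> \<gamma>. \<forall>x\<in>grade H \<alpha>. \<forall>y\<in>grade H \<beta>. \<forall>z\<in>grade H \<gamma>.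
        zsign (\<gamma> * \<alpha>) * sympl H x (bracket H y z)
        + zsign (\<alpha> * \<beta>) * sympl H y (bracket H z x)
        + zsign (\<beta> * \<gamma>) * sympl H z (bracket H x y) = 0"
  proof (intro allI ballI)
    fix x y z \<alpha> \<beta> \<gamma> assume h: "x \<in> grade H \<alpha>" "y \<in> grade H \<beta>" "z \<in> grade H \<gamma>"
    then have g: "x \<in> grade L \<alpha>" "y \<in> grade L \<beta>" "z \<in> grade L \<gamma>" by auto
    show "zsign (\<gamma> * \<alpha>) * sympl H x (bracket H y z)
        + zsign (\<alpha> * \<beta>) * sympl H y (bracket H z x)
        + zsign (\<beta> * \<gamma>) * sympl H z (bracket H x y) = 0"
      using sympl_cocycle[OF g] h[THEN H_grade_carrier] g[THEN grade_carrier]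
      by (simp add: sympl_P_right del: H_simps(1))
  qed
qed

lemma H_odd_quadratic_odd_symplectic: "odd_quadratic_odd_symplectic scale H"
  by (intro odd_quadratic_odd_symplectic.intro odd_quadratic_odd_symplectic_axioms.intro
      H_lie_superalgebra H_form H_sympl)

lemma H_associated: "associated_superderivation scale H \<delta>\<^sub>H"
  unfolding associated_superderivation_def superderivation_def
proof (intro conjI)
  show lin: "linear_on (carrier H) scale scale \<delta>\<^sub>H"
    unfolding linear_on_def using in_H(1) by (auto simp: \<delta>\<^sub>H_def \<delta>.add \<delta>.scale P_lin)
  show "\<forall>\<alpha>. \<delta>\<^sub>H ` grade H \<alpha> \<subseteq> grade H (\<alpha> + 0)"
    using P_grade_H \<delta>_grade unfolding \<delta>\<^sub>H_def by auto
  show "\<forall>\<alpha>. \<forall>x\<in>grade H \<alpha>. \<forall>y\<in>carrier H. \<delta>\<^sub>H (bracket H x y) =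
      bracket H (\<delta>\<^sub>H x) y + scale (zsign (0 * \<alpha>)) (bracket H x (\<delta>\<^sub>H y))"
  proof (intro allI ballI)
    fix \<alpha> x y assume x: "x \<in> grade H \<alpha>" and y: "y \<in> carrier H"
    note xH = in_H[OF H_grade_carrier[OF x]] and yH = in_H[OF y]
    show "\<delta>\<^sub>H (bracket H x y) =
      bracket H (\<delta>\<^sub>H x) y + scale (zsign (0 * \<alpha>)) (bracket H x (\<delta>\<^sub>H y))"
      using xH yH
      by (simp add: \<delta>\<^sub>H_def P_\<delta>_P \<delta>_derivation P_lin bracket_P_left bracket_P_right form_es_\<delta>)
  qed
  show "\<forall>x\<in>carrier H. \<forall>y\<in>carrier H. sympl H x y = form H (\<delta>\<^sub>H x) y"
    using H_sympl_eq by simp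
  show "bij_betw \<delta>\<^sub>H (carrier H) (carrier H)"
    unfolding bij_betw_def
  proof
    show "inj_on \<delta>\<^sub>H (carrier H)"
    proof (rule inj_onI)
      fix x y assume xy: "x \<in> carrier H" "y \<in> carrier H" "\<delta>\<^sub>H x = \<delta>\<^sub>H y"
      have "x - y \<in> carrier H" using xy unfolding carrier_H by (auto simp: form_lin)
      moreover have "\<delta>\<^sub>H (x - y) = 0"
        using xy in_H(1) by (simp add: \<delta>\<^sub>H_def \<delta>.diff P_lin)
      ultimately have "x - y = 0" by (rule \<delta>\<^sub>H_injective)
      then show "x = y" by simp
    qed
    have onto: "\<exists>x\<in>carrier L. \<delta> x = y" if "y \<in> carrier L" for y
    proof -
      obtain A where A: "finite A" "carrier L = span A" using finite_dim by blast
      obtain C where C: "C \<subseteq> carrier L" "independent C" "carrier L \<subseteq> span C"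
        using maximal_independent_subset by blast
      have sp: "carrier L = span C" using C(1,3) span_minimal carrier_subspace by blast
      have "finite C" using independent_span_bound[OF A(1) C(2)] C(1) A(2) by blast
      then have "\<delta> ` span C = span C"
        using sp C(2) \<delta>_injective \<delta>_carrier by (intro injective_image_spans linear) auto
      then have "y \<in> \<delta> ` carrier L" using sp that by simp
      then show ?thesis by blast
    qed
    show "\<delta>\<^sub>H ` carrier H = carrier H"
    proof
      show "\<delta>\<^sub>H ` carrier H \<subseteq> carrier H" using \<delta>\<^sub>H_carrier by blast
      show "carrier H \<subseteq> \<delta>\<^sub>H ` carrier H"
      proof
        fix y assume y: "y \<in> carrier H"
        obtain x where x: "x \<in> carrier L" "\<delta> x = y" using onto in_H(1)[OF y] by blast
        have "form L es x = 0" using form_es_\<delta>[OF x(1)] in_H[OF y] x(2) l_nonzero by simp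
        then have "\<delta>\<^sub>H (P x) = y" using x in_H[OF y] by (simp add: \<delta>\<^sub>H_def P_\<delta>_P)
        then show "y \<in> \<delta>\<^sub>H ` carrier H" using x(1) by (metis P_in_H imageI)
      qed
    qed
  qed
qed

lemma D_superderivation: "superderivation scale H 1 D"
  unfolding superderivation_def
proof (intro conjI)
  show "linear_on (carrier H) scale scale D"
    unfolding linear_on_def using in_H(1) by (auto simp: D_def br_lin P_lin)
  show "\<forall>\<alpha>. D ` grade H \<alpha> \<subseteq> grade H (\<alpha> + 1)"
  proof safe
    fix \<alpha> x assume "x \<in> grade H \<alpha>"
    then have "x \<in> grade L \<alpha>" by simp
    then show "D x \<in> grade H (\<alpha> + 1)"
      using P_grade_H[OF bracket_grade[OF e_odd]] unfolding D_def by (metis add.commute)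
  qed
  show "\<forall>\<alpha>. \<forall>x\<in>grade H \<alpha>. \<forall>y\<in>carrier H. D (bracket H x y) =
      bracket H (D x) y + scale (zsign (1 * \<alpha>)) (bracket H x (D y))"
  proof (intro allI ballI)
    fix \<alpha> x y assume x: "x \<in> grade H \<alpha>" and y: "y \<in> carrier H"
    note xH = in_H[OF H_grade_carrier[OF x]] and yH = in_H[OF y]
    have g: "x \<in> grade L \<alpha>" using x by simp
    show "D (bracket H x y) = bracket H (D x) y + scale (zsign (1 * \<alpha>)) (bracket H x (D y))"
      using xH yH leibniz[OF e_odd g yH(1)]
      by (simp add: D_def P_lin bracket_P_left bracket_P_right)
  qed
qed

lemma bracket_e_swap: "x \<in> grade L \<alpha> \<Longrightarrow> bracket L x e = - scale (zsign \<alpha>) (bracket L e x)"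
  using bracket_skew[OF _ e_odd, of x \<alpha>] by simp

lemma D_skew: "skew_supersymmetric H 1 D"
  unfolding skew_supersymmetric_def
proof (intro allI ballI)
  fix \<alpha> x y assume x: "x \<in> grade H \<alpha>" and y: "y \<in> carrier H"
  note xc = H_grade_carrier[OF x]
  note xH = in_H[OF xc] and yH = in_H[OF y]
  have g: "x \<in> grade L \<alpha>" using x by simp
  have "form L x (bracket L e y) = form L (bracket L x e) y" using xH yH by (simp add: form_invariant)
  also have "\<dots> = - zsign \<alpha> * form L (bracket L e x) y"
    using xH yH by (simp add: bracket_e_swap[OF g] form_lin)
  finally show "form H (D x) y = - zsign (1 * \<alpha>) * form H x (D y)"
    using xH yH y xc by (cases \<alpha>) (simp_all add: D_def form_P_left form_P_right)
qed

text \<open>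
  The \<open>es\<close>- and \<open>e\<close>-coordinates of \<open>[e,e]\<close> and \<open>\<delta>(e)\<close>.  The former has no \<open>e\<close>-part since it is a
  bracket, the latter no \<open>es\<close>-part since \<open>B(\<delta>(e),e) = \<omega>(e,e) = 0\<close>.
\<close>

lemma bracket_e_e_expand: "bracket L e e = scale k es + x\<^sub>0"
  using decomposition[of "bracket L e e"] by (simp add: k_def x\<^sub>0_def)

lemma \<delta>_e_expand: "\<delta> e = c\<^sub>1 - scale l e"
proof -
  have "form L (\<delta> e) e = 0" using sympl_eq[of e e] sympl_odd[OF e_odd e_odd] by simp
  then show ?thesis using decomposition[of "\<delta> e"] by (simp add: c\<^sub>1_def form_es_\<delta>)
qed

lemma x\<^sub>0_even: "x\<^sub>0 \<in> grade H 0" and c\<^sub>1_odd: "c\<^sub>1 \<in> grade H 1"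
  using P_grade_H[OF bracket_grade[OF e_odd e_odd]] P_grade_H[OF \<delta>_grade[OF e_odd]]
  unfolding x\<^sub>0_def c\<^sub>1_def by (simp_all del: H_simps)

lemmas x\<^sub>0_carrier = H_grade_carrier[OF x\<^sub>0_even] and c\<^sub>1_carrier = H_grade_carrier[OF c\<^sub>1_odd]

lemmas x\<^sub>0_H [simp] = in_H[OF x\<^sub>0_carrier] and c\<^sub>1_H [simp] = in_H[OF c\<^sub>1_carrier]

lemma e_squared: "x \<in> carrier L \<Longrightarrow> scale 2 (bracket L e (bracket L e x)) = bracket L (bracket L e e) x"
  using leibniz[OF e_odd e_odd, of x] scale_left_distrib[of 1 1 "bracket L e (bracket L e x)"]
  by (simp add: eq_diff_eq)

text \<open>
  The Leibniz rule gives \<open>2[e,[e,e]] = [[e,e],e]\<close>, and evenness of \<open>[e,e]\<close> turns the right side into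
  \<open>-[e,[e,e]]\<close>, so \<open>3[e,[e,e]] = 0\<close>.
\<close>

lemma e_cubed: "bracket L e (bracket L e e) = 0"
proof -
  have "bracket L (bracket L e e) e = - bracket L e (bracket L e e)"
    using bracket_even_skew[of "bracket L e e" e] bracket_grade[OF e_odd e_odd] by simp
  then have "scale 2 (bracket L e (bracket L e e)) + scale 1 (bracket L e (bracket L e e)) = 0"
    using e_squared[of e] by simp
  then have "scale 3 (bracket L e (bracket L e e)) = 0"
    unfolding scale_left_distrib[symmetric] by simp
  then show ?thesis by simp
qed

lemma \<delta>_e_e: "\<delta> (bracket L e e) = scale 2 (bracket L e (\<delta> e))"
  using \<delta>_derivation[of e e] bracket_odd_sym[OF \<delta>_grade[OF e_odd] e_odd]
    scale_left_distrib[of 1 1 "bracket L e (\<delta> e)"] by simp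

text \<open>
  Pair \<open>\<delta>[e,e] = 2[e,\<delta>(e)]\<close> with \<open>e\<close>.  Writing \<open>t = B([e,e],\<delta>(e))\<close>, the left side is \<open>-t\<close> by
  skewness of \<open>\<delta>\<close> and the right side \<open>2t\<close> by invariance, so \<open>t = 0\<close>; expanding \<open>t\<close> gives the claim.
\<close>

lemma form_c\<^sub>1_x\<^sub>0: "form L c\<^sub>1 x\<^sub>0 = l * k"
proof -
  let ?t = "form L (bracket L e e) (\<delta> e)"
  have "form L (bracket L e (\<delta> e)) e = form L e (bracket L (\<delta> e) e)" by (simp add: form_invariant)
  also have "\<dots> = ?t"
    using bracket_odd_sym[OF \<delta>_grade[OF e_odd] e_odd] by (simp add: form_invariant)
  finally have "form L (\<delta> (bracket L e e)) e = 2 * ?t" by (simp add: \<delta>_e_e form_lin)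
  moreover have "form L (\<delta> (bracket L e e)) e = - ?t" by (simp add: \<delta>_skew)
  ultimately have "3 * ?t = 0" by simp
  then have "?t = 0" by simp
  moreover have "?t = form L x\<^sub>0 c\<^sub>1 - l * k"
    unfolding bracket_e_e_expand \<delta>_e_expand by (simp add: form_lin)
  ultimately show ?thesis using form_sym[of x\<^sub>0 c\<^sub>1] by simp
qed

lemma extension_data: "odd_double_extension_data scale H \<delta>\<^sub>H D x\<^sub>0 k c\<^sub>1 l"
  unfolding odd_double_extension_data_def
proof (intro conjI H_associated D_superderivation D_skew x\<^sub>0_even c\<^sub>1_odd l_nonzero ballI)
  show "D x\<^sub>0 = 0" unfolding D_def x\<^sub>0_def by (simp add: bracket_P_right e_cubed)
  show "form H c\<^sub>1 x\<^sub>0 = l * k" by (simp add: form_c\<^sub>1_x\<^sub>0)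
  have "\<delta>\<^sub>H x\<^sub>0 = P (\<delta> (bracket L e e))" unfolding \<delta>\<^sub>H_def x\<^sub>0_def by (simp add: P_\<delta>_P)
  also have "\<dots> = scale 2 (P (bracket L e (c\<^sub>1 - scale l e)))"
    unfolding \<delta>_e_e \<delta>_e_expand by (simp add: P_lin)
  also have "\<dots> = scale 2 (D c\<^sub>1) - scale (2 * l) x\<^sub>0"
    by (simp add: br_lin P_lin D_def x\<^sub>0_def scale_right_diff_distrib)
  finally show "scale 2 (D c\<^sub>1) = \<delta>\<^sub>H x\<^sub>0 + scale (2 * l) x\<^sub>0" by simp
next
  fix x assume x: "x \<in> carrier H"
  note xH = in_H[OF x]
  have "D (D x) = P (bracket L e (bracket L e x))"
    unfolding D_def using xH by (simp add: bracket_P_right)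
  also have "\<dots> = scale (1 / 2) (P (scale 2 (bracket L e (bracket L e x))))"
    using xH by (simp add: P_lin)
  also have "\<dots> = scale (1 / 2) (bracket H x\<^sub>0 x)"
    using xH by (simp add: e_squared x\<^sub>0_def bracket_P_left)
  finally show "D (D x) = scale (1 / 2) (bracket H x\<^sub>0 x)" .
  have "\<delta>\<^sub>H (D x) = P (bracket L (\<delta> e) x) + P (bracket L e (\<delta> x))"
    using xH by (simp add: \<delta>\<^sub>H_def D_def P_\<delta>_P \<delta>_derivation P_lin)
  also have "P (bracket L (\<delta> e) x) = bracket H c\<^sub>1 x - scale l (D x)"
    unfolding \<delta>_e_expand using xH by (simp add: br_lin P_lin D_def)
  also have "P (bracket L e (\<delta> x)) = D (\<delta>\<^sub>H x)"
    unfolding \<delta>\<^sub>H_def D_def using xH by (simp add: bracket_P_right form_es_\<delta>)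
  finally show "supercommutator scale 0 1 \<delta>\<^sub>H D x + scale l (D x) = bracket H c\<^sub>1 x"
    by (simp add: supercommutator_def)
qed

definition \<phi> :: "'v \<Rightarrow> 'k \<times> 'v \<times> 'k" where
  "\<phi> x = (form L x e, P x, form L es x)"

text \<open>
  The definite description in \<open>hcomp\<close> is meaningful because the two components of \<open>H\<close> meet in zero.
\<close>

lemma hcomp_H:
  assumes x: "x \<in> carrier H"
  shows "hcomp H \<alpha> x \<in> grade H \<alpha>" "hcomp H 0 x + hcomp H 1 x = x"
proof -
  interpret H: lie_superalgebra scale H by (rule H_lie_superalgebra)
  obtain a b where ab: "a \<in> grade H 0" "b \<in> grade H 1" "x = a + b" using x by (rule H.carrierE)
  have uniq: "hcomp H \<alpha> x = u" if "u \<in> grade H \<alpha>" "v \<in> grade H (\<alpha> + 1)" "x = u + v" for \<alpha> u v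
    unfolding hcomp_def
  proof (rule the_equality)
    show "u \<in> grade H \<alpha> \<and> x - u \<in> grade H (\<alpha> + 1)" using that by (simp del: H_simps)
    fix y assume y: "y \<in> grade H \<alpha> \<and> x - y \<in> grade H (\<alpha> + 1)"
    have "u - y \<in> grade H \<alpha>" by (rule H.grade_closed(4)) (use that y in blast)+
    moreover have "(x - y) - v \<in> grade H (\<alpha> + 1)" by (rule H.grade_closed(4)) (use that y in blast)+
    then have "u - y \<in> grade H (\<alpha> + 1)" using that(3) by (simp add: algebra_simps del: H_simps)
    ultimately have "u - y \<in> grade H 0 \<inter> grade H 1" by (cases \<alpha>) auto
    then show "y = u" unfolding H.grade_Int by simp
  qed
  have 0: "hcomp H 0 x = a" by (rule uniq[of a 0 b]) (use ab in \<open>simp_all del: H_simps\<close>)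
  have 1: "hcomp H 1 x = b" by (rule uniq[of b 1 a]) (use ab in \<open>simp_all add: add.commute del: H_simps\<close>)
  show "hcomp H \<alpha> x \<in> grade H \<alpha>" using 0 1 ab by (cases \<alpha>) (simp_all del: H_simps)
  show "hcomp H 0 x + hcomp H 1 x = x" using 0 1 ab by simp
qed

text \<open>
  Super-antisymmetry moves \<open>e\<close> to the left at the cost of a sign on the even component.
\<close>

lemma bracket_e_right:
  assumes x: "x \<in> carrier H"
  shows "hcomp H 1 x - hcomp H 0 x \<in> carrier H"
    and "bracket L x e = bracket L e (hcomp H 1 x - hcomp H 0 x)"
proof -
  have g: "hcomp H 0 x \<in> grade L 0" "hcomp H 1 x \<in> grade L 1"
    using hcomp_H(1)[OF x, of 0] hcomp_H(1)[OF x, of 1] by auto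
  have h: "hcomp H 0 x \<in> carrier H" "hcomp H 1 x \<in> carrier H"
    by (rule H_grade_carrier[OF hcomp_H(1)[OF x]])+
  note c = g[THEN grade_carrier]
  show "hcomp H 1 x - hcomp H 0 x \<in> carrier H"
    using h unfolding carrier_H by (simp add: form_lin)
  have "bracket L x e = bracket L (hcomp H 0 x + hcomp H 1 x) e" using hcomp_H(2)[OF x] by simp
  also have "\<dots> = bracket L e (hcomp H 1 x - hcomp H 0 x)"
    using c by (simp add: br_lin bracket_e_swap[OF g(1)] bracket_e_swap[OF g(2)])
  finally show "bracket L x e = bracket L e (hcomp H 1 x - hcomp H 0 x)" .
qed

lemma form_bracket_e_e:
  assumes "x \<in> carrier H" shows "form L (bracket L e x) e = form L x\<^sub>0 x"
proof -
  note xH = in_H[OF assms]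
  have "form L (bracket L e x) e = form L (bracket L e e) x"
    using xH form_sym[of "bracket L e x" e] by (simp add: form_invariant)
  then show ?thesis using xH by (simp add: bracket_e_e_expand form_lin)
qed

lemma \<phi>_bracket:
  assumes x: "x \<in> carrier L" and y: "y \<in> carrier L"
  shows "\<phi> (bracket L x y) = ext_bracket scale H D x\<^sub>0 k (\<phi> x) (\<phi> y)"
proof -
  let ?a = "form L x e" and ?b = "form L es x" and ?X = "P x"
  let ?c = "form L y e" and ?d = "form L es y" and ?Y = "P y"
  let ?X' = "hcomp H 1 ?X - hcomp H 0 ?X"
  have X: "?X \<in> carrier H" and Y: "?Y \<in> carrier H" using x y by simp_all
  note XH = in_H[OF X] and YH = in_H[OF Y]
  have X': "?X' \<in> carrier H" "bracket L ?X e = bracket L e ?X'"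
    using bracket_e_right[OF X] by auto
  note X'H = in_H[OF X'(1)]
  have "bracket L x y = bracket L (scale ?a es + ?X + scale ?b e) (scale ?c es + ?Y + scale ?d e)"
    using decomposition[of x] decomposition[of y] by simp
  also have "\<dots> = bracket L ?X ?Y + scale ?b (bracket L e ?Y) + scale ?d (bracket L e ?X')
      + scale (?b * ?d) (bracket L e e)"
    using XH(1) YH(1)
    by (simp add: br_lin es_central es_central_right X'(2) scale_right_distrib algebra_simps)
  finally have br: "bracket L x y = \<dots>" .
  have XY: "form L (bracket L ?X ?Y) e = form L (D ?X) ?Y"
  proof -
    have "form L (bracket L ?X ?Y) e = form L (bracket L e ?X) ?Y"
      using XH(1) YH(1) form_sym[of "bracket L ?X ?Y" e] by (simp add: form_invariant)
    then show ?thesis unfolding D_def using XH(1) Y by (simp add: form_P_left)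
  qed
  have 1: "form L (bracket L x y) e = form L (D ?X) ?Y + ?b * form L x\<^sub>0 ?Y + ?d * form L x\<^sub>0 ?X' + ?b * ?d * k"
    unfolding br using XH(1) YH(1) X'H(1)
    by (simp add: form_lin XY form_bracket_e_e[OF Y] form_bracket_e_e[OF X'(1)] k_def)
  have 2: "P (bracket L x y) = bracket H ?X ?Y + scale ?b (D ?Y) + scale ?d (D ?X') + scale (?b * ?d) x\<^sub>0"
    unfolding br using XH(1) YH(1) X'H(1) by (simp add: P_lin D_def x\<^sub>0_def)
  show ?thesis
    unfolding \<phi>_def ext_bracket_def using 1 2 x y by (simp add: Let_def)
qed

lemma form_decomposed:
  assumes x: "x \<in> carrier L" and y: "y \<in> carrier L"
  shows "form L x y = form L (P x) (P y) + form L x e * form L es y + form L es x * form L y e"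
proof -
  note h = in_H[OF P_in_H[OF x]] in_H[OF P_in_H[OF y]]
  have "form L x y = form L (scale (form L x e) es + P x + scale (form L es x) e)
      (scale (form L y e) es + P y + scale (form L es y) e)"
    using decomposition[of x] decomposition[of y] by simp
  also have "\<dots> = form L (P x) (P y) + form L x e * form L es y + form L es x * form L y e"
    using h by (simp add: form_lin)
  finally show ?thesis .
qed

lemma \<phi>_form: "\<lbrakk>x \<in> carrier L; y \<in> carrier L\<rbrakk> \<Longrightarrow> ext_form H (\<phi> x) (\<phi> y) = form L x y"
  using form_decomposed[of x y] by (simp add: \<phi>_def ext_form_def)

text \<open>
  Since \<open>\<omega> = B(\<delta>(-),-)\<close> on both sides, compatibility with \<open>B\<close> and with \<open>\<delta>\<close> yields compatibility with
  \<open>\<omega>\<close>.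
\<close>

lemma \<phi>_\<delta>:
  assumes x: "x \<in> carrier L"
  shows "ext_derivation scale H \<delta>\<^sub>H c\<^sub>1 l (\<phi> x) = \<phi> (\<delta> x)"
proof -
  note h = in_H[OF P_in_H[OF x]]
  have "form L (\<delta> x) e = - form L x (c\<^sub>1 - scale l e)"
    using x by (simp add: \<delta>_skew flip: \<delta>_e_expand)
  also have "form L x (c\<^sub>1 - scale l e) = form L c\<^sub>1 (P x) - l * form L x e"
    using x form_sym[of x c\<^sub>1] by (simp add: form_lin form_P_right[OF c\<^sub>1_carrier])
  finally have 1: "form L (\<delta> x) e = l * form L x e - form L c\<^sub>1 (P x)" by simp
  have "P (\<delta> x) = P (\<delta> (scale (form L x e) es + P x + scale (form L es x) e))"
    using decomposition[of x] by simp
  also have "\<dots> = \<delta>\<^sub>H (P x) + scale (form L es x) c\<^sub>1"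
    using h(1) by (simp add: \<delta>.add \<delta>.scale P_lin \<delta>_es \<delta>\<^sub>H_def c\<^sub>1_def)
  finally have 2: "P (\<delta> x) = \<dots>" .
  show ?thesis
    using 1 2 x by (simp add: \<phi>_def ext_derivation_def form_es_\<delta>)
qed

lemma \<phi>_inverse:
  assumes "x \<in> carrier H" shows "\<phi> (scale a es + x + scale b e) = (a, x, b)"
  using in_H[OF assms] by (simp add: \<phi>_def form_lin P_lin)

lemma \<phi>_inj: "\<lbrakk>\<phi> x = \<phi> y\<rbrakk> \<Longrightarrow> x = y"
  using decomposition[of x] decomposition[of y] by (simp add: \<phi>_def)

lemma extension_isomorphism:
  "bi_form_isomorphism scale L (ext_scale scale) (odd_double_extension scale H \<delta>\<^sub>H D x\<^sub>0 k c\<^sub>1 l) \<phi>"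
proof -
  let ?M = "odd_double_extension scale H \<delta>\<^sub>H D x\<^sub>0 k c\<^sub>1 l"
  have lin: "linear_on (carrier L) scale (ext_scale scale) \<phi>"
    unfolding linear_on_def by (auto simp: \<phi>_def ext_scale_def form_lin P_lin)
  have gr: "\<phi> ` grade L \<alpha> = grade ?M \<alpha>" for \<alpha>
  proof
    show "\<phi> ` grade L \<alpha> \<subseteq> grade ?M \<alpha>"
    proof (rule image_subsetI)
      fix x assume x: "x \<in> grade L \<alpha>"
      have "P x \<in> grade H \<alpha>" by (rule P_grade_H[OF x])
      moreover have "\<alpha> = 0 \<Longrightarrow> form L es x = 0" "\<alpha> = 1 \<Longrightarrow> form L x e = 0"
        using form_odd x es_even e_odd by auto
      ultimately show "\<phi> x \<in> grade ?M \<alpha>"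
        by (cases \<alpha>) (auto simp: odd_double_extension_def ext_grade_def \<phi>_def)
    qed
    show "grade ?M \<alpha> \<subseteq> \<phi> ` grade L \<alpha>"
    proof
      fix u assume u: "u \<in> grade ?M \<alpha>"
      obtain a x b where abx: "u = (a, x, b)" "x \<in> grade H \<alpha>" "\<alpha> = 0 \<Longrightarrow> b = 0" "\<alpha> = 1 \<Longrightarrow> a = 0"
        using u by (cases \<alpha>) (auto simp: odd_double_extension_def ext_grade_def)
      have "scale a es + x + scale b e \<in> grade L \<alpha>"
        using abx es_even e_odd by (cases \<alpha>) (auto intro!: grade_closed)
      then show "u \<in> \<phi> ` grade L \<alpha>"
        using \<phi>_inverse[OF H_grade_carrier[OF abx(2)], of a b] abx(1) by (metis imageI)
    qed
  qed
  have add: "\<phi> (x + y) = \<phi> x + \<phi> y" if "x \<in> carrier L" "y \<in> carrier L" for x y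
    using lin that unfolding linear_on_def by blast
  have "\<phi> ` carrier L = carrier ?M"
  proof
    show "\<phi> ` carrier L \<subseteq> carrier ?M"
    proof (rule image_subsetI)
      fix x assume "x \<in> carrier L"
      then obtain a b where ab: "a \<in> grade L 0" "b \<in> grade L 1" "x = a + b" by (rule carrierE)
      have "\<phi> x = \<phi> a + \<phi> b" unfolding ab(3) by (intro add grade_carrier[OF ab(1)] grade_carrier[OF ab(2)])
      moreover have "\<phi> a \<in> grade ?M 0" "\<phi> b \<in> grade ?M 1" using gr ab(1,2) by blast+
      ultimately show "\<phi> x \<in> carrier ?M" unfolding carrier_def[of ?M] by blast
    qed
    show "carrier ?M \<subseteq> \<phi> ` carrier L"
    proof
      fix u assume "u \<in> carrier ?M"
      then obtain v w where vw: "v \<in> grade ?M 0" "w \<in> grade ?M 1" "u = v + w"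
        unfolding carrier_def by blast
      then obtain x y where "x \<in> grade L 0" "v = \<phi> x" "y \<in> grade L 1" "w = \<phi> y"
        by (metis gr imageE)
      then have "u = \<phi> (x + y)" "x + y \<in> carrier L" using vw(3) add grade_carrier by auto
      then show "u \<in> \<phi> ` carrier L" by blast
    qed
  qed
  then have bij: "bij_betw \<phi> (carrier L) (carrier ?M)"
    unfolding bij_betw_def using \<phi>_inj by (auto intro: inj_onI)
  show ?thesis
    unfolding bi_form_isomorphism_def
    using lin gr bij
    by (simp add: odd_double_extension_def \<phi>_bracket \<phi>_form \<phi>_\<delta> sympl_eq)
qed

lemma is_extension_of_H: "is_generalized_odd_double_extension scale L scale H"
  unfolding is_generalized_odd_double_extension_def
  using extension_data extension_isomorphism by blast

end

theorem proposition4p2: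
  fixes scale :: "'k::{alg_closed_field, field_char_0} \<Rightarrow> 'v::ab_group_add \<Rightarrow> 'v"
    and G :: "('k, 'v) bi_form_superalgebra"
  assumes "odd_quadratic_odd_symplectic scale G"
    and "carrier G \<noteq> {0}"
  shows "\<exists>H :: ('k, 'v) bi_form_superalgebra.
           odd_quadratic_odd_symplectic scale H \<and>
           is_generalized_odd_double_extension scale G scale H"
proof -
  interpret odd_quadratic_odd_symplectic scale G by (rule assms(1))
  obtain \<delta> where \<delta>: "Vector_Spaces.linear scale scale \<delta>" "\<delta> ` carrier G \<subseteq> carrier G"
      "\<And>x y. x \<in> carrier G \<Longrightarrow> y \<in> carrier G \<Longrightarrow> sympl G x y = form G (\<delta> x) y"
    using associated_map_exists by blast
  interpret odd_quadratic_with_derivation scale G \<delta>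
  proof (intro odd_quadratic_with_derivation.intro odd_quadratic_with_derivation_axioms.intro endomorphism.intro
      endomorphism_axioms.intro vector_space_axioms assms(1))
    show "Vector_Spaces.linear scale scale \<delta>" by (rule \<delta>(1))
    show "\<delta> x \<in> carrier G" if "x \<in> carrier G" for x using \<delta>(2) that by blast
    show "sympl G x y = form G (\<delta> x) y" if "x \<in> carrier G" "y \<in> carrier G" for x y
      by (rule \<delta>(3)[OF that])
  qed
  obtain z a where z: "z \<in> grade G 0" "z \<noteq> 0" "a \<noteq> 0" "\<delta> z = scale a z"
      "\<And>x. x \<in> carrier G \<Longrightarrow> bracket G z x = 0"
    using central_even_eigenvector_exists[OF assms(2)] by blast
  obtain e where e: "e \<in> grade G 1" "form G z e = 1"
    using dual_odd_vector_exists[OF z(1,2)] by blast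
  interpret central_even_eigenvector scale G \<delta> z e a
    by (intro central_even_eigenvector.intro central_even_eigenvector_axioms.intro
        odd_quadratic_with_derivation_axioms z e)
  show ?thesis
    using H_odd_quadratic_odd_symplectic is_extension_of_H by blast
qed

end
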